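(* Let $n\ge 2$ be an integer and $\alpha>0$ real. For a partition $\lambda$ of $n$ let $$W_\alpha(\lambda)=\frac{\sum_{x\in\lambda}c_\alpha(x)}{\sqrt{\alpha\binom{n}{2}}},$$ and let $W_\alpha$ be the value of $W_\alpha(\lambda)$ when $\lambda$ is a random partition of $n$ distributed according to the $\mathrm{Jack}_\alpha$ measure. Then for $Z$ a standard normal random variable, $$\|\mathcal{L}(W_\alpha)-\mathcal{L}(Z)\|_1\le\sqrt{\frac{2}{n}}\left(2+\sqrt{2+\frac{\max(\alpha,1/\alpha)}{n-1}}\right).$$
   Context: Partitions of $n$ are identified with their Young diagrams (rows of left-justified boxes, of weakly decreasing length from top to bottom). For a box $x$ of $\lambda$, the arm $a(x)$ is the number of boxes in the same row as $x$ and to the right of $x$, and the leg $l(x)$ is the number of boxes in the same column as $x$ and below $x$. For $\alpha>0$, the $\mathrm{Jack}_\alpha$ measure on partitions of size $n$ is the probability measure $$\mathrm{Jack}_\alpha(\lambda)=\frac{\alpha^n n!}{\prod_{x\in\lambda}(\alpha a(x)+l(x)+1)(\alpha a(x)+l(x)+\alpha)}.$$ The $\alpha$-content of a box $x$ is $c_\alpha(x)=\alpha\,(\text{column number of }x-1)-(\text{row number of }x-1)$, where the top-left box has row number 1 and column number 1, and the minus one is applied to the column (resp. row) number. $\mathcal{L}(X)$ denotes the distribution of $X$, and $\|\mathcal{L}(X)-\mathcal{L}(Y)\|_1=\int_{-\infty}^\infty|P(X\le t)-P(Y\le t)|\,dt$ is the $L^1$ (Wasserstein-1) distance. *)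

theory Defs
  imports "HOL-Probability.Probability"
begin

text \<open>A partition is the list of its parts, in weakly decreasing order and all positive.\<close>

definition partitions_of :: "nat \<Rightarrow> nat list set" where
  "partitions_of n = {p. sorted_wrt (\<ge>) p \<and> 0 \<notin> set p \<and> sum_list p = n}"

text \<open>Boxes are pairs (row, column), counted from 0. So the coordinates of a box are its
  row number minus one and its column number minus one in the usual numbering, where the top-left
  box has row number 1 and column number 1.\<close>

definition boxes :: "nat list \<Rightarrow> (nat \<times> nat) set" where
  "boxes p = {(i, j). i < length p \<and> j < p ! i}"

definition arm :: "nat list \<Rightarrow> nat \<times> nat \<Rightarrow> nat" where
  "arm p x = card {y \<in> boxes p. fst y = fst x \<and> snd y > snd x}"

definition leg :: "nat list \<Rightarrow> nat \<times> nat \<Rightarrow> nat" where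
  "leg p x = card {y \<in> boxes p. snd y = snd x \<and> fst y > fst x}"

definition jack_weight :: "nat \<Rightarrow> real \<Rightarrow> nat list \<Rightarrow> real" where
  "jack_weight n \<alpha> p =
     \<alpha> ^ n * fact n /
     (\<Prod>x\<in>boxes p. (\<alpha> * real (arm p x) + real (leg p x) + 1) *
                   (\<alpha> * real (arm p x) + real (leg p x) + \<alpha>))"

definition jack_measure :: "nat \<Rightarrow> real \<Rightarrow> nat list measure" where
  "jack_measure n \<alpha> = point_measure (partitions_of n) (\<lambda>p. ennreal (jack_weight n \<alpha> p))"

definition alpha_content :: "real \<Rightarrow> nat \<times> nat \<Rightarrow> real" where
  "alpha_content \<alpha> x = \<alpha> * real (snd x) - real (fst x)"

definition jack_W :: "nat \<Rightarrow> real \<Rightarrow> nat list \<Rightarrow> real" where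
  "jack_W n \<alpha> p = (\<Sum>x\<in>boxes p. alpha_content \<alpha> x) / sqrt (\<alpha> * real (n choose 2))"

text \<open>The \<open>L\<^sup>1\<close> distance of two laws on the real line. It takes values in \<^typ>\<open>ennreal\<close>, so that a
  bound on it includes the finiteness of the integral.\<close>

definition L1_dist :: "real measure \<Rightarrow> real measure \<Rightarrow> ennreal" where
  "L1_dist M N = (\<integral>\<^sup>+ t. ennreal \<bar>cdf M t - cdf N t\<bar> \<partial>lborel)"

end

theory Submission
  imports Defs "HOL-Computational_Algebra.Polynomial_FPS" "HOL-Real_Asymp.Real_Asymp"
begin

text \<open>Grow the random partition one box at a time with Kerov's transition probabilities. The content
  \<open>c\<close> of the box added to a partition of size \<open>n - 1\<close> has conditional mean \<open>0\<close> and the constant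
  conditional variance \<open>\<alpha> (n - 1)\<close>, while its mean given the resulting partition is \<open>2 / n\<close> times the
  content sum \<open>S\<close>. So \<open>E (S f S) = (n / 2) E (c f (S' + c))\<close> with \<open>S = S' + c\<close>, and for \<open>W = S / \<sigma>\<close> a
  Taylor expansion around \<open>S' / \<sigma>\<close> bounds \<open>\<bar>E (f' W - W f W)\<bar>\<close> by
  \<open>2 E \<bar>c\<bar> / \<sigma> + E \<bar>c\<bar>\<^sup>3 / (\<alpha> (n - 1) \<sigma>)\<close> whenever \<open>f'\<close> is \<open>2\<close>-Lipschitz. The solution of the Stein equation for
  a \<open>1\<close>-Lipschitz test function has this property, and the \<open>L\<^sup>1\<close> distance is attained by a test function
  whose slope is the sign of the difference of the distribution functions. The Cauchy-Schwarz inequality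
  reduces the two moments to \<open>E c\<^sup>2\<close> and \<open>E c\<^sup>4\<close>.

  The conditional moments of \<open>c\<close> are the coefficients at infinity of a rational function whose poles and
  zeros are the contents of the corners; Newton's identities express them by power sums over the boxes.\<close>

section \<open>Partial fractions and Newton's identities\<close>

text \<open>Since the conditional variance is constant, the main terms of the expansion cancel
  exactly: with \<open>u = c / \<sigma>\<close> and \<open>K = n / 2\<close>, the conditional mean
  of \<open>K * u^2\<close> is 1. Only remainders are left, and no variance of a conditional second
  moment has to be estimated, as it usually is with exchangeable pairs. The constants can be read
  off: \<open>E u^2 = 2 / n\<close> gives the factor \<open>sqrt (2 / n)\<close>, the 2 in the
  bracket is the Lipschitz constant of \<open>f'\<close>, and the inner root bounds
  \<open>K^2 * E u^4 = 2 + (\<alpha> - 3 + 1 / \<alpha>) / (n - 1)\<close>. The measure is a product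
  over hooks, the growth a product over corners. They meet in a single identity,
  \<open>hook_product_ratio\<close>; the rest, including total mass 1, follows from it by residues.
  Partitions are padded with zero rows to a fixed number \<open>N\<close> of rows, larger than the
  size. Corners then need no bookkeeping, and the empty last row removes the spurious pole at
  \<open>- N\<close>.\<close>

definition pf_coeff :: "'i set \<Rightarrow> ('i \<Rightarrow> real) \<Rightarrow> ('i \<Rightarrow> real) \<Rightarrow> 'i \<Rightarrow> real" where
  "pf_coeff I a b i = (\<Prod>j\<in>I. a i - b j) / (\<Prod>j\<in>I - {i}. a i - a j)"

text \<open>Lagrange interpolation: both sides are monic of degree \<open>card I\<close>, because
  the sum has smaller degree, so it suffices to compare them at the \<open>card I\<close> distinct
  points \<open>a i\<close>. At \<open>a k\<close> only the summand \<open>k\<close>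
  survives.\<close>

lemma partial_fraction_poly:
  assumes I: "finite I" and a: "inj_on a I"
  shows "(\<Prod>i\<in>I. [:- b i, 1:]) = (\<Prod>i\<in>I. [:- a i, 1:]) +
           (\<Sum>i\<in>I. smult (pf_coeff I a b i) (\<Prod>j\<in>I - {i}. [:- a j, 1:]))"
    (is "?L = ?P + ?S")
proof (rule poly_eqI_degree_lead_coeff[where n = "card I" and A = "a ` I"])
  have deg: "degree (\<Prod>i\<in>J. [:- c i, 1:]) = card J" for J and c :: "'a \<Rightarrow> real"
    by (subst degree_prod_sum_eq) auto
  have monic: "coeff (\<Prod>i\<in>I. [:- c i, 1:]) (card I) = 1" for c :: "'a \<Rightarrow> real"
    using lead_coeff_prod[of "\<lambda>i. [:- c i, 1:]" I] by (simp add: deg)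
  show "degree ?L \<le> card I" by (simp add: deg)
  have "degree (smult (pf_coeff I a b i) (\<Prod>j\<in>I - {i}. [:- a j, 1:])) < card I" if "i \<in> I" for i
    using degree_smult_le[of "pf_coeff I a b i" "\<Prod>j\<in>I - {i}. [:- a j, 1:]"]
      card_Diff1_less[OF I that] by (simp only: deg)
  note small_summand = this
  have small: "coeff ?S (card I) = 0"
    unfolding coeff_sum by (intro sum.neutral ballI coeff_eq_0 small_summand)
  have deg_S: "degree ?S \<le> card I"
    by (intro degree_sum_le I less_imp_le small_summand)
  show "degree (?P + ?S) \<le> card I"
    by (rule degree_add_le) (simp_all add: deg deg_S)
  show "coeff ?L (card I) = coeff (?P + ?S) (card I)"
    by (simp only: coeff_add monic small add_0_right)
  show "card I \<le> card (a ` I)" by (simp add: card_image a)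
  fix z assume "z \<in> a ` I"
  then obtain k where k: "k \<in> I" and z: "z = a k" by auto
  have nz: "(\<Prod>j\<in>I - {k}. a k - a j) \<noteq> 0"
    using a k by (auto simp: I inj_on_def)
  have "poly ?S z = (\<Sum>i\<in>I. if i = k then pf_coeff I a b k * (\<Prod>j\<in>I - {k}. a k - a j) else 0)"
    unfolding poly_sum
  proof (rule sum.cong[OF refl])
    fix i assume "i \<in> I"
    show "poly (smult (pf_coeff I a b i) (\<Prod>j\<in>I - {i}. [:- a j, 1:])) z =
        (if i = k then pf_coeff I a b k * (\<Prod>j\<in>I - {k}. a k - a j) else 0)"
      using I k by (auto simp: poly_prod z intro!: prod_zero)
  qed
  also have "\<dots> = (\<Prod>j\<in>I. a k - b j)"
    using I k nz by (simp add: pf_coeff_def)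
  finally show "poly ?L z = poly (?P + ?S) z"
    using I k by (auto simp: poly_prod z intro!: prod_zero)
qed

text \<open>The substitution \<open>z = 1 / t\<close> moves the expansion at infinity to 0, where
  formal power series apply. The factor \<open>[:0, 1:]\<close> appears because a product over
  \<open>I - {i}\<close> has one factor less.\<close>

lemma partial_fraction_reversed:
  assumes I: "finite I" and a: "inj_on a I"
  shows "(\<Prod>i\<in>I. [:1, - b i:]) = (\<Prod>i\<in>I. [:1, - a i:]) +
           [:0, 1:] * (\<Sum>i\<in>I. smult (pf_coeff I a b i) (\<Prod>j\<in>I - {i}. [:1, - a j:]))"
    (is "?L = ?R")
proof -
  have "poly ?L t = poly ?R t" for t
  proof (cases "t = 0")
    case True
    then show ?thesis by (simp add: poly_prod)
  next
    case False
    have scale: "t ^ card J * (\<Prod>i\<in>J. 1 / t - c i) = (\<Prod>i\<in>J. 1 - t * c i)" for J and c :: "'a \<Rightarrow> real"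
      by (simp add: prod_constant[symmetric] prod.distrib[symmetric] False algebra_simps del: prod_constant)
    have "(\<Prod>i\<in>I. 1 / t - b i) = (\<Prod>i\<in>I. 1 / t - a i) +
        (\<Sum>i\<in>I. pf_coeff I a b i * (\<Prod>j\<in>I - {i}. 1 / t - a j))"
      using arg_cong[OF partial_fraction_poly[OF assms, of b], of "\<lambda>p. poly p (1 / t)"]
      by (simp add: poly_sum poly_prod)
    then have "t ^ card I * (\<Prod>i\<in>I. 1 / t - b i) = t ^ card I * (\<Prod>i\<in>I. 1 / t - a i) +
        (\<Sum>i\<in>I. pf_coeff I a b i * (t ^ card I * (\<Prod>j\<in>I - {i}. 1 / t - a j)))"
      by (simp add: distrib_left sum_distrib_left mult.left_commute)
    also have "(\<Sum>i\<in>I. pf_coeff I a b i * (t ^ card I * (\<Prod>j\<in>I - {i}. 1 / t - a j))) =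
        t * (\<Sum>i\<in>I. pf_coeff I a b i * (\<Prod>j\<in>I - {i}. 1 - t * a j))"
      unfolding sum_distrib_left
    proof (rule sum.cong[OF refl])
      fix i assume i: "i \<in> I"
      then have "card I = Suc (card (I - {i}))" using I by (metis card_Suc_Diff1)
      then show "pf_coeff I a b i * (t ^ card I * (\<Prod>j\<in>I - {i}. 1 / t - a j)) =
          t * (pf_coeff I a b i * (\<Prod>j\<in>I - {i}. 1 - t * a j))"
        by (simp only: power_Suc scale[symmetric]) (simp add: mult_ac)
    qed
    finally show ?thesis
      unfolding scale by (simp add: poly_sum poly_prod)
  qed
  then show ?thesis by (simp add: poly_eq_poly_eq_iff[symmetric] fun_eq_iff)
qed

section \<open>Logarithmic derivatives of formal power series\<close>

definition fps_geo :: "real \<Rightarrow> real fps" where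
  "fps_geo c = Abs_fps (\<lambda>n. c ^ n)"

lemma fps_geo_inverse: "(1 - fps_const c * fps_X) * fps_geo c = 1"
proof (rule fps_ext)
  fix n show "fps_nth ((1 - fps_const c * fps_X) * fps_geo c) n = fps_nth 1 n"
    by (cases n) (simp_all add: fps_geo_def left_diff_distrib mult.assoc)
qed

text \<open>The series \<open>fps_const c * fps_geo c\<close> is \<open>c / (1 - c X)\<close>, with
  coefficients \<open>c ^ Suc m\<close>. So minus the logarithmic derivative of the product
  generates the power sums of the \<open>c i\<close>.\<close>

lemma fps_deriv_prod_linear:
  assumes "finite I"
  shows "fps_deriv (\<Prod>i\<in>I. 1 - fps_const (c i) * fps_X) =
    - (\<Prod>i\<in>I. 1 - fps_const (c i) * fps_X) * (\<Sum>i\<in>I. fps_const (c i) * fps_geo (c i))"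
  using assms
proof induction
  case (insert i I)
  let ?l = "1 - fps_const (c i) * fps_X" and ?A = "\<Prod>i\<in>I. 1 - fps_const (c i) * fps_X"
    and ?G = "\<Sum>i\<in>I. fps_const (c i) * fps_geo (c i)"
  have ring: "l * (- P * Q) + k * P = k * P - l * P * Q" for l P Q k :: "real fps"
    by (simp add: mult.assoc)
  have ring': "- ((l * g) * k * P) - l * P * Q = - (l * P) * (k * g + Q)" for l P Q k g :: "real fps"
    by (simp add: algebra_simps)
  have dl: "fps_deriv ?l = - fps_const (c i)" by simp
  have "fps_deriv (?l * ?A) = - fps_const (c i) * ?A - ?l * ?A * ?G"
    unfolding fps_deriv_mult insert.IH dl by (rule ring)
  also have "\<dots> = - ((?l * fps_geo (c i)) * fps_const (c i) * ?A) - ?l * ?A * ?G"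
    by (simp only: fps_geo_inverse mult_1_left mult_minus_left)
  also have "\<dots> = - (?l * ?A) * (fps_const (c i) * fps_geo (c i) + ?G)"
    by (rule ring')
  finally show ?case using insert.hyps by simp
qed simp

text \<open>Newton's identities for the expansion at infinity of \<open>\<Prod>(z - b i) / \<Prod>(z - a i)\<close>.\<close>

lemma pf_moment_newton:
  fixes a b :: "'i \<Rightarrow> real"
  assumes I: "finite I" and a: "inj_on a I"
  defines "H \<equiv> (\<lambda>k. if k = 0 then 1 else \<Sum>i\<in>I. pf_coeff I a b i * a i ^ (k - 1))"
  shows "real (Suc k) * H (Suc k) =
    (\<Sum>j\<le>k. H j * ((\<Sum>i\<in>I. a i ^ Suc (k - j)) - (\<Sum>i\<in>I. b i ^ Suc (k - j))))"
proof -
  define G where "G = Abs_fps H"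
  define A where "A = (\<Prod>i\<in>I. 1 - fps_const (a i) * fps_X :: real fps)"
  define B where "B = (\<Prod>i\<in>I. 1 - fps_const (b i) * fps_X :: real fps)"
  define Ga where "Ga = (\<Sum>i\<in>I. fps_const (a i) * fps_geo (a i))"
  define Gb where "Gb = (\<Sum>i\<in>I. fps_const (b i) * fps_geo (b i))"
  have G: "G = 1 + fps_X * (\<Sum>i\<in>I. fps_const (pf_coeff I a b i) * fps_geo (a i))"
  proof (rule fps_ext)
    fix n show "fps_nth G n =
        fps_nth (1 + fps_X * (\<Sum>i\<in>I. fps_const (pf_coeff I a b i) * fps_geo (a i))) n"
      by (cases n) (simp_all add: G_def H_def fps_sum_nth fps_geo_def)
  qed
  have lin: "fps_of_poly [:1, - c:] = 1 - fps_const c * fps_X" for c :: real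
    by (simp add: fps_of_poly_pCons fps_const_neg[symmetric] del: fps_const_neg)
  have "A * G = A + fps_X * (\<Sum>i\<in>I. fps_const (pf_coeff I a b i) * (A * fps_geo (a i)))"
    by (simp add: G algebra_simps sum_distrib_left)
  also have "(\<Sum>i\<in>I. fps_const (pf_coeff I a b i) * (A * fps_geo (a i))) =
      (\<Sum>i\<in>I. fps_const (pf_coeff I a b i) * (\<Prod>j\<in>I - {i}. 1 - fps_const (a j) * fps_X))"
  proof (rule sum.cong[OF refl])
    fix i assume "i \<in> I"
    then have "A = (1 - fps_const (a i) * fps_X) * (\<Prod>j\<in>I - {i}. 1 - fps_const (a j) * fps_X)"
      using I by (simp add: A_def prod.remove)
    then have "A * fps_geo (a i) = ((1 - fps_const (a i) * fps_X) * fps_geo (a i)) *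
        (\<Prod>j\<in>I - {i}. 1 - fps_const (a j) * fps_X)"
      by (simp add: mult_ac)
    then show "fps_const (pf_coeff I a b i) * (A * fps_geo (a i)) =
        fps_const (pf_coeff I a b i) * (\<Prod>j\<in>I - {i}. 1 - fps_const (a j) * fps_X)"
      by (simp add: fps_geo_inverse)
  qed
  also have "A + fps_X * \<dots> = B"
    using arg_cong[OF partial_fraction_reversed[OF I a, of b], of fps_of_poly]
    unfolding fps_of_poly_add fps_of_poly_mult fps_of_poly_sum fps_of_poly_smult
      fps_of_poly_prod lin fps_of_poly_fps_X A_def B_def by (rule sym)
  finally have AG: "A * G = B" .
  have dA: "fps_deriv A = - A * Ga" and dB: "fps_deriv B = - B * Gb"
    unfolding A_def B_def Ga_def Gb_def by (rule fps_deriv_prod_linear[OF I])+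
  \<comment> \<open>This is \<open>G' / G = B' / B - A' / A\<close> with denominators cleared; the
    nonzero factor \<open>A\<close> is cancelled at the end.\<close>
  have "A * fps_deriv G = fps_deriv (A * G) - fps_deriv A * G"
    by simp
  also have "\<dots> = - (A * G) * Gb + A * Ga * G"
    by (simp only: AG dA dB) simp
  also have "\<dots> = A * (G * (Ga - Gb))"
    by (simp add: algebra_simps)
  finally have "A * fps_deriv G = A * (G * (Ga - Gb))" .
  moreover have "A \<noteq> 0"
  proof -
    have "1 - fps_const (a i) * fps_X \<noteq> 0" for i
      using fps_geo_inverse[of "a i"] by force
    then show ?thesis using I by (simp add: A_def)
  qed
  ultimately have "fps_deriv G = G * (Ga - Gb)" by simp
  then have "fps_nth (fps_deriv G) k = (\<Sum>j\<le>k. H j * fps_nth (Ga - Gb) (k - j))"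
    by (simp add: G_def fps_mult_nth atLeast0AtMost)
  moreover have "fps_nth Ga m = (\<Sum>i\<in>I. a i ^ Suc m)" "fps_nth Gb m = (\<Sum>i\<in>I. b i ^ Suc m)" for m
    by (simp_all add: Ga_def Gb_def fps_sum_nth fps_geo_def)
  ultimately show ?thesis by (simp add: G_def)
qed

section \<open>Transition weights and their moments\<close>

text \<open>With zero rows included, adding a box is a function update, and the same
  \<open>N\<close> serves all sizes along the growth.\<close>

definition row_functions :: "nat \<Rightarrow> nat \<Rightarrow> (nat \<Rightarrow> nat) set" where
  "row_functions N n = {f. antimono f \<and> (\<forall>i\<ge>N. f i = 0) \<and> (\<Sum>i<N. f i) = n}"

text \<open>The content of the box that would extend row \<open>i\<close>.\<close>

definition row_end :: "real \<Rightarrow> (nat \<Rightarrow> nat) \<Rightarrow> nat \<Rightarrow> real" where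
  "row_end \<alpha> f i = \<alpha> * real (f i) - real i"

text \<open>Kerov's weights are products over corners. Taking the products over all rows makes no difference,
  since the factors of consecutive rows of equal length cancel, and the weight of a row to which no box
  can be added (or from which none can be removed) vanishes.\<close>

definition up_weight :: "real \<Rightarrow> nat \<Rightarrow> (nat \<Rightarrow> nat) \<Rightarrow> nat \<Rightarrow> real" where
  "up_weight \<alpha> N f i =
     (\<Prod>j\<in>{..<N} - {i}. (row_end \<alpha> f i - row_end \<alpha> f j + 1) / (row_end \<alpha> f i - row_end \<alpha> f j)) /
     (row_end \<alpha> f i + real N)"

definition down_weight :: "real \<Rightarrow> nat \<Rightarrow> (nat \<Rightarrow> nat) \<Rightarrow> nat \<Rightarrow> real" where
  "down_weight \<alpha> N f i = (row_end \<alpha> f i - 1 + real N) *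
     (\<Prod>j\<in>{..<N} - {i}. (row_end \<alpha> f i - row_end \<alpha> f j - 1) / (row_end \<alpha> f i - row_end \<alpha> f j))"

definition box_sum :: "real \<Rightarrow> nat \<Rightarrow> nat \<Rightarrow> (nat \<Rightarrow> nat) \<Rightarrow> real" where
  "box_sum \<alpha> N k f = (\<Sum>i<N. \<Sum>j<f i. (\<alpha> * real j - real i) ^ k)"

lemma row_end_diff:
  assumes "\<alpha> > 0" "antimono f" "i < j"
  shows "row_end \<alpha> f i - row_end \<alpha> f j \<ge> 1"
proof -
  have "f j \<le> f i" using assms by (simp add: antimonoD)
  then have "\<alpha> * real (f j) \<le> \<alpha> * real (f i)" using assms by simp
  then show ?thesis using assms(3) by (simp add: row_end_def)
qed

lemma inj_on_row_end:
  assumes "\<alpha> > 0" "antimono f"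
  shows "inj_on (row_end \<alpha> f) I"
proof (rule inj_onI)
  fix i j assume "row_end \<alpha> f i = row_end \<alpha> f j"
  then show "i = j"
    using row_end_diff[OF assms, of i j] row_end_diff[OF assms, of j i] by (cases i j rule: linorder_cases) auto
qed

lemma row_end_pos: "\<alpha> > 0 \<Longrightarrow> i < N \<Longrightarrow> row_end \<alpha> f i + real N > 0"
  by (simp add: row_end_def) (smt (verit) mult_nonneg_nonneg of_nat_0_le_iff of_nat_less_iff)

text \<open>For \<open>\<phi> t = t ^ k\<close> the left-hand side is the power sum of the poles minus that of the zeros of the
  rational function defining the up weights. Every box of content \<open>c\<close> contributes a mixed second
  difference of \<open>\<phi>\<close> at \<open>c\<close>.\<close>

lemma row_end_telescope:
  fixes \<phi> :: "real \<Rightarrow> real"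
  shows "(\<Sum>i<N. \<phi> (row_end \<alpha> f i)) - (\<Sum>i<N. \<phi> (row_end \<alpha> f i - 1)) + \<phi> (- real N) =
    \<phi> 0 + (\<Sum>i<N. \<Sum>j<f i. \<phi> (\<alpha> * real j - real i + \<alpha>) - \<phi> (\<alpha> * real j - real i + \<alpha> - 1)
      - \<phi> (\<alpha> * real j - real i) + \<phi> (\<alpha> * real j - real i - 1))"
proof -
  \<comment> \<open>The second difference telescopes along each row; what is left at the left ends
    \<open>- real i\<close> telescopes in turn down the rows.\<close>
  have row: "(\<Sum>j<m. \<phi> (\<alpha> * real j - real i + \<alpha>) - \<phi> (\<alpha> * real j - real i + \<alpha> - 1)
      - \<phi> (\<alpha> * real j - real i) + \<phi> (\<alpha> * real j - real i - 1)) =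
      \<phi> (\<alpha> * real m - real i) - \<phi> (\<alpha> * real m - real i - 1) - \<phi> (- real i) + \<phi> (- real i - 1)" for m i
    by (induction m) (simp_all add: algebra_simps)
  have "(\<Sum>i<N. \<phi> (- real i) - \<phi> (- real i - 1)) = \<phi> 0 - \<phi> (- real N)"
  proof (induction N)
    case (Suc N)
    have "- real (Suc N) = - real N - 1" by simp
    with Suc show ?case by (simp only: sum.lessThan_Suc)
  qed simp
  then show ?thesis
    unfolding row by (simp add: row_end_def sum.distrib sum_subtractf algebra_simps)
qed

definition power_sum :: "real \<Rightarrow> nat \<Rightarrow> nat \<Rightarrow> (nat \<Rightarrow> nat) \<Rightarrow> real" where
  "power_sum \<alpha> N k f = (\<Sum>i<N. row_end \<alpha> f i ^ k) - (\<Sum>i<N. (row_end \<alpha> f i - 1) ^ k) + (- real N) ^ k"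

text \<open>The second difference lowers the degree of \<open>t ^ k\<close> by two, so the power sum
  of order \<open>k\<close> involves box sums of order at most \<open>k - 2\<close>, with leading
  coefficient \<open>k * (k - 1) * \<alpha>\<close>.\<close>

lemma power_sum_eq:
  shows "power_sum \<alpha> N 1 f = 0"
    and "power_sum \<alpha> N 2 f = 2 * \<alpha> * box_sum \<alpha> N 0 f"
    and "power_sum \<alpha> N 3 f = 6 * \<alpha> * box_sum \<alpha> N 1 f + 3 * \<alpha> * (\<alpha> - 1) * box_sum \<alpha> N 0 f"
    and "power_sum \<alpha> N 4 f = 12 * \<alpha> * box_sum \<alpha> N 2 f + 12 * \<alpha> * (\<alpha> - 1) * box_sum \<alpha> N 1 f
           + (4 * \<alpha> ^ 3 - 6 * \<alpha>\<^sup>2 + 4 * \<alpha>) * box_sum \<alpha> N 0 f"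
proof -
  have d2: "(c + \<alpha>)\<^sup>2 - (c + \<alpha> - 1)\<^sup>2 - c\<^sup>2 + (c - 1)\<^sup>2 = 2 * \<alpha> * c ^ 0" for c :: real
    by (simp add: power2_eq_square algebra_simps)
  have d3: "(c + \<alpha>) ^ 3 - (c + \<alpha> - 1) ^ 3 - c ^ 3 + (c - 1) ^ 3 =
      6 * \<alpha> * c ^ 1 + 3 * \<alpha> * (\<alpha> - 1) * c ^ 0" for c :: real
    by (simp add: power3_eq_cube algebra_simps)
  have d4: "(c + \<alpha>) ^ 4 - (c + \<alpha> - 1) ^ 4 - c ^ 4 + (c - 1) ^ 4 =
      12 * \<alpha> * c ^ 2 + 12 * \<alpha> * (\<alpha> - 1) * c ^ 1 + (4 * \<alpha> ^ 3 - 6 * \<alpha>\<^sup>2 + 4 * \<alpha>) * c ^ 0" for c :: real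
    by (simp add: power4_eq_xxxx power3_eq_cube power2_eq_square algebra_simps)
  show "power_sum \<alpha> N 1 f = 0"
    using row_end_telescope[of "\<lambda>x. x"] by (simp add: power_sum_def)
  show "power_sum \<alpha> N 2 f = 2 * \<alpha> * box_sum \<alpha> N 0 f"
    using row_end_telescope[of "\<lambda>x. x ^ 2" \<alpha> f N] unfolding d2
    by (simp add: power_sum_def box_sum_def sum_distrib_left mult_ac)
  show "power_sum \<alpha> N 3 f = 6 * \<alpha> * box_sum \<alpha> N 1 f + 3 * \<alpha> * (\<alpha> - 1) * box_sum \<alpha> N 0 f"
    using row_end_telescope[of "\<lambda>x. x ^ 3" \<alpha> f N] unfolding d3
    by (simp only: power_sum_def box_sum_def sum_distrib_left sum.distrib power_zero_numeral add_0_left)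
  show "power_sum \<alpha> N 4 f = 12 * \<alpha> * box_sum \<alpha> N 2 f + 12 * \<alpha> * (\<alpha> - 1) * box_sum \<alpha> N 1 f
           + (4 * \<alpha> ^ 3 - 6 * \<alpha>\<^sup>2 + 4 * \<alpha>) * box_sum \<alpha> N 0 f"
    using row_end_telescope[of "\<lambda>x. x ^ 4" \<alpha> f N] unfolding d4
    by (simp only: power_sum_def box_sum_def sum_distrib_left sum.distrib power_zero_numeral add_0_left)
qed

text \<open>The parameter \<open>B\<close> is a free extra zero: \<open>B = 0\<close> gives the moments of positive order, and comparing
  with \<open>B = 1\<close> gives the total mass.\<close>

lemma up_weight_pf_coeff:
  assumes \<alpha>: "\<alpha> > 0" and f: "antimono f" and last: "f M = 0" and i: "i < Suc M"
  shows "pf_coeff {..<Suc M} (row_end \<alpha> f) (\<lambda>j. if j = M then B else row_end \<alpha> f j - 1) i =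
    up_weight \<alpha> (Suc M) f i * (row_end \<alpha> f i - B)"
proof -
  let ?x = "row_end \<alpha> f" and ?I = "{..<Suc M}"
  let ?b = "\<lambda>j. if j = M then B else ?x j - 1"
  \<comment> \<open>The empty row \<open>M\<close> has row end \<open>- M\<close>, so its zero
    \<open>- M - 1\<close> cancels the pole at \<open>- real (Suc M)\<close>. The slot that this
    frees carries the zero \<open>B\<close>.\<close>
  have "(\<Prod>j\<in>?I. ?x i - ?b j) * (?x i + real (Suc M)) =
      (?x i - B) * (\<Prod>j\<in>{..<M}. ?x i - ?x j + 1) * (?x i - ?x M + 1)"
    by (simp add: last row_end_def algebra_simps)
  also have "\<dots> = (?x i - B) * (\<Prod>j\<in>?I. ?x i - ?x j + 1)"
    by (simp add: mult_ac)
  also have "\<dots> = (?x i - B) * (\<Prod>j\<in>?I - {i}. ?x i - ?x j + 1)"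
    using i by (subst prod.remove[of _ i]) auto
  finally have "(\<Prod>j\<in>?I. ?x i - ?b j) =
      (?x i - B) * (\<Prod>j\<in>?I - {i}. ?x i - ?x j + 1) / (?x i + real (Suc M))"
    using row_end_pos[OF \<alpha> i, of f] by (intro eq_divide_imp) auto
  then show ?thesis
    unfolding pf_coeff_def up_weight_def prod_dividef by (simp add: mult_ac)
qed

lemma up_weight_moments:
  assumes \<alpha>: "\<alpha> > 0" and f: "antimono f" and last: "f M = 0"
  defines "N \<equiv> Suc M"
  defines "m \<equiv> (\<lambda>k. \<Sum>i<N. up_weight \<alpha> N f i * row_end \<alpha> f i ^ k)"
  shows "m 0 = 1" and "m 1 = 0" and "m 2 = power_sum \<alpha> N 2 f / 2"
    and "m 4 = power_sum \<alpha> N 4 f / 4 + (power_sum \<alpha> N 2 f)\<^sup>2 / 8"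
proof -
  let ?x = "row_end \<alpha> f" and ?I = "{..<N}"
  define b where "b B = (\<lambda>j. if j = M then B else ?x j - 1)" for B
  have sum_b: "(\<Sum>i<N. ?x i ^ k) - (\<Sum>i<N. b B i ^ k) = power_sum \<alpha> N k f - B ^ k" for B k
  proof -
    have "?x M - 1 = - real (Suc M)" by (simp add: row_end_def last)
    then show ?thesis by (simp add: power_sum_def N_def b_def del: of_nat_Suc)
  qed
  have pf: "pf_coeff ?I ?x (b B) i = up_weight \<alpha> N f i * (?x i - B)" if "i < N" for B i
    unfolding N_def b_def by (rule up_weight_pf_coeff) (use assms that in \<open>auto simp: N_def\<close>)
  note newton = pf_moment_newton[OF finite_lessThan[of N] inj_on_row_end[OF \<alpha> f], where b = "b B" for B, unfolded sum_b]
  have M0: "(\<Sum>i<N. pf_coeff ?I ?x (b B) i) = - B" for B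
    using newton[of 0 B] power_sum_eq(1)[of \<alpha> N f] by simp
  have "(\<Sum>i<N. pf_coeff ?I ?x (b B) i) = m 1 - B * m 0" for B
    by (simp add: m_def pf sum_subtractf right_diff_distrib sum_distrib_left mult_ac)
  with M0[of 0] M0[of 1] show m0: "m 0 = 1" and m1: "m 1 = 0" by simp_all
  have M: "(\<Sum>i<N. pf_coeff ?I ?x (b 0) i * ?x i ^ k) = m (Suc k)" for k
    by (simp add: m_def pf mult_ac)
  define H where "H k = (if k = 0 then 1 else m k)" for k
  have "(if k = 0 then 1 else \<Sum>i<N. pf_coeff ?I ?x (b 0) i * ?x i ^ (k - 1)) = H k" for k
    using M[of "k - 1"] by (simp add: H_def)
  note nw = newton[of _ 0, unfolded this]
  have H1: "H 1 = 0" using m1 by (simp add: H_def)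
  have H2: "2 * H 2 = power_sum \<alpha> N 2 f"
    using nw[of 1] H1 power_sum_eq(1)[of \<alpha> N f] by (simp add: H_def numeral_2_eq_2)
  have H3: "3 * H 3 = power_sum \<alpha> N 3 f"
    using nw[of 2] H1 H2 power_sum_eq(1)[of \<alpha> N f]
    by (simp add: H_def numeral_2_eq_2 numeral_3_eq_3)
  have H4: "4 * H 4 = power_sum \<alpha> N 4 f + H 2 * power_sum \<alpha> N 2 f"
    using nw[of 3] H1 H2 H3 power_sum_eq(1)[of \<alpha> N f]
    by (simp add: H_def eval_nat_numeral)
  show m2: "m 2 = power_sum \<alpha> N 2 f / 2" using H2 by (simp add: H_def)
  show "m 4 = power_sum \<alpha> N 4 f / 4 + (power_sum \<alpha> N 2 f)\<^sup>2 / 8"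
    using H4 m2 by (simp add: H_def power2_eq_square)
qed

text \<open>The down weights are minus the residues, at the points
  \<open>row_end \<alpha> f i - 1\<close>, of the reciprocal of the function behind the up weights.
  Poles and zeros swap roles, so the power sums change sign; the extra factor \<open>z + N\<close>
  of the reciprocal combines each moment with the next one.\<close>

lemma down_weight_moments:
  assumes \<alpha>: "\<alpha> > 0" and f: "antimono f"
  shows "(\<Sum>i<N. down_weight \<alpha> N f i) = power_sum \<alpha> N 2 f / 2"
    and "(\<Sum>i<N. down_weight \<alpha> N f i * (row_end \<alpha> f i - 1)) = power_sum \<alpha> N 3 f / 3"
proof -
  let ?x = "row_end \<alpha> f" and ?I = "{..<N}"
  let ?y = "\<lambda>i. ?x i - 1"
  have inj: "inj_on ?y ?I"
    using inj_on_row_end[OF \<alpha> f, of ?I] by (simp add: inj_on_def)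
  have pf: "down_weight \<alpha> N f i = - (pf_coeff ?I ?y ?x i * ?y i + real N * pf_coeff ?I ?y ?x i)"
    if "i < N" for i
  proof -
    have "(\<Prod>j\<in>?I. ?y i - ?x j) = - (\<Prod>j\<in>?I - {i}. ?x i - ?x j - 1)"
      using that by (subst prod.remove[of _ i]) (auto simp: algebra_simps)
    then have "pf_coeff ?I ?y ?x i = - (\<Prod>j\<in>?I - {i}. (?x i - ?x j - 1) / (?x i - ?x j))"
      by (simp add: pf_coeff_def prod_dividef)
    then show ?thesis by (simp add: down_weight_def algebra_simps)
  qed
  define H where "H k = (if k = 0 then 1 else \<Sum>i<N. pf_coeff ?I ?y ?x i * ?y i ^ (k - 1))" for k
  have ps: "(\<Sum>i<N. ?y i ^ k) - (\<Sum>i<N. ?x i ^ k) = (- real N) ^ k - power_sum \<alpha> N k f" for k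
    by (simp add: power_sum_def)
  note nw = pf_moment_newton[OF finite_lessThan inj, where b = ?x, unfolded ps, folded H_def]
  have H0: "H 0 = 1" by (simp add: H_def)
  have H1: "H 1 = - real N"
    using nw[of 0] power_sum_eq(1)[of \<alpha> N f] by (simp add: H0)
  have H2: "2 * H 2 = 2 * (real N)\<^sup>2 - power_sum \<alpha> N 2 f"
    using nw[of 1] H1 power_sum_eq(1)[of \<alpha> N f] by (simp add: H0 numeral_2_eq_2 power2_eq_square)
  have NH2: "real N * (2 * H 2) = real N * (2 * (real N)\<^sup>2 - power_sum \<alpha> N 2 f)"
    by (simp only: H2)
  have H3: "3 * H 3 = - 3 * real N ^ 3 + 3 / 2 * real N * power_sum \<alpha> N 2 f - power_sum \<alpha> N 3 f"
    using nw[of 2] H1 H2 NH2 power_sum_eq(1)[of \<alpha> N f]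
    by (simp add: H0 eval_nat_numeral algebra_simps)
  have "(\<Sum>i<N. down_weight \<alpha> N f i) = - (H 2 + real N * H 1)"
    by (simp add: H_def pf sum_negf sum.distrib sum_distrib_left sum_subtractf)
  also have "\<dots> = power_sum \<alpha> N 2 f / 2"
    using H1 H2 by (simp add: power2_eq_square)
  finally show "(\<Sum>i<N. down_weight \<alpha> N f i) = power_sum \<alpha> N 2 f / 2" .
  have "(\<Sum>i<N. down_weight \<alpha> N f i * ?y i) = - (H 3 + real N * H 2)"
    by (simp add: H_def pf sum_negf sum.distrib sum_distrib_left algebra_simps power2_eq_square
        sum_subtractf)
  also have "\<dots> = power_sum \<alpha> N 3 f / 3"
    using NH2 H3 by (simp add: power2_eq_square power3_eq_cube algebra_simps)
  finally show "(\<Sum>i<N. down_weight \<alpha> N f i * ?y i) = power_sum \<alpha> N 3 f / 3" .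
qed

section \<open>Hook products\<close>

definition leg_length :: "nat \<Rightarrow> (nat \<Rightarrow> nat) \<Rightarrow> nat \<Rightarrow> nat \<Rightarrow> nat" where
  "leg_length N f i j = card {k \<in> {i<..<N}. j < f k}"

definition row_hook :: "real \<Rightarrow> nat \<Rightarrow> (nat \<Rightarrow> nat) \<Rightarrow> nat \<Rightarrow> real" where
  "row_hook \<alpha> N f i = (\<Prod>j<f i.
     (\<alpha> * real (f i - Suc j) + real (leg_length N f i j) + 1) *
     (\<alpha> * real (f i - Suc j) + real (leg_length N f i j) + \<alpha>))"

definition hook_product :: "real \<Rightarrow> nat \<Rightarrow> (nat \<Rightarrow> nat) \<Rightarrow> real" where
  "hook_product \<alpha> N f = (\<Prod>i<N. row_hook \<alpha> N f i)"

lemma prod_telescope_quotient: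
  fixes h :: "nat \<Rightarrow> real"
  assumes "\<And>j. j \<le> d \<Longrightarrow> h j \<noteq> 0"
  shows "(\<Prod>j<d. h j / h (Suc j)) = h 0 / h d"
  using assms by (induction d) auto

text \<open>Row \<open>M\<close> is the lowest and shortest, so a column that reaches it passes
  through all rows between \<open>i\<close> and \<open>M\<close>.\<close>

lemma leg_length_Suc:
  assumes "antimono f" "i < M"
  shows "leg_length (Suc M) f i j = (if j < f M then M - i else leg_length M f i j)"
proof (cases "j < f M")
  case True
  have "f M \<le> f k" if "k < Suc M" for k
    using assms(1) that by (simp add: antimonoD)
  with True have "{k \<in> {i<..<Suc M}. j < f k} = {i<..<Suc M}"
    by (auto intro: less_le_trans)
  then show ?thesis using True by (simp add: leg_length_def)
next
  case False
  then have "{k \<in> {i<..<Suc M}. j < f k} = {k \<in> {i<..<M}. j < f k}"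
    by (auto simp: less_Suc_eq)
  then show ?thesis using False by (simp add: leg_length_def)
qed

text \<open>The leg length is constant on the columns that end in the same row, where the product
  telescopes. Peeling off the lowest row turns this into an induction.\<close>

lemma row_prod_telescope:
  fixes g :: "nat \<Rightarrow> nat \<Rightarrow> real"
  assumes f: "antimono f" and c: "\<And>k. r < k \<Longrightarrow> f k \<le> c"
    and g: "\<And>j l. j \<le> c \<Longrightarrow> g j l \<noteq> 0" and M: "Suc r \<le> M"
  shows "(\<Prod>j<c. g j (leg_length M f r j) / g (Suc j) (leg_length M f r j)) =
    g 0 (M - Suc r) / g c 0 * (\<Prod>k\<in>{r<..<M}. g (f k) (k - Suc r) / g (f k) (k - r))"
  using M
proof (induction M rule: dec_induct)
  case base
  have "leg_length (Suc r) f r j = 0" for j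
    by (simp add: leg_length_def)
  moreover have "{r<..<Suc r} = {}" by auto
  ultimately show ?case using prod_telescope_quotient[of c "\<lambda>j. g j 0"] g by simp
next
  case (step M)
  then have rM: "r < M" by simp
  define d where "d = f M"
  have d: "d \<le> c" unfolding d_def by (rule c[OF rM])
  have full: "leg_length M f r j = M - Suc r" if "j < d" for j
  proof -
    have "d \<le> f k" if "k < M" for k
      using f that by (simp add: d_def antimonoD)
    with that have "{k \<in> {r<..<M}. j < f k} = {r<..<M}" by (auto intro: less_le_trans)
    then show ?thesis by (simp add: leg_length_def)
  qed
  let ?q = "\<lambda>l j. g j l / g (Suc j) l"
  \<comment> \<open>Row \<open>M\<close> changes the leg only in the first \<open>f M\<close>
    columns, from \<open>M - Suc r\<close> to \<open>M - r\<close>. The correction factors telescope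
    over these columns.\<close>
  have "(\<Prod>j<c. ?q (leg_length (Suc M) f r j) j) =
      (\<Prod>j<c. ?q (leg_length M f r j) j * (if j < d then ?q (M - r) j / ?q (M - Suc r) j else 1))"
  proof (rule prod.cong[OF refl])
    fix j assume "j \<in> {..<c}"
    then have "g j l \<noteq> 0" "g (Suc j) l \<noteq> 0" for l using g by auto
    then show "?q (leg_length (Suc M) f r j) j =
        ?q (leg_length M f r j) j * (if j < d then ?q (M - r) j / ?q (M - Suc r) j else 1)"
      using full[of j] by (simp add: leg_length_Suc[OF f rM] d_def)
  qed
  also have "\<dots> = (\<Prod>j<c. ?q (leg_length M f r j) j) * (\<Prod>j<d. ?q (M - r) j / ?q (M - Suc r) j)"
    unfolding prod.distrib using d
    by (simp add: prod.If_cases Collect_conj_eq lessThan_def[symmetric] Int_absorb1 inf_commute)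
  also have "(\<Prod>j<d. ?q (M - r) j / ?q (M - Suc r) j) =
      (g 0 (M - r) / g d (M - r)) / (g 0 (M - Suc r) / g d (M - Suc r))"
    unfolding prod_dividef[of "?q (M - r)"] using g d
    by (subst (1 2) prod_telescope_quotient) auto
  also have "{r<..<Suc M} = insert M {r<..<M}" using rM by auto
  then have "(\<Prod>j<c. ?q (leg_length M f r j) j) *
      ((g 0 (M - r) / g d (M - r)) / (g 0 (M - Suc r) / g d (M - Suc r))) =
      g 0 (Suc M - Suc r) / g c 0 * (\<Prod>k\<in>{r<..<Suc M}. g (f k) (k - Suc r) / g (f k) (k - r))"
    unfolding step.IH using g[of 0] g[OF d] by (simp add: d_def)
  finally show ?case .
qed

text \<open>The new box lengthens a single column, number \<open>f r\<close>. In a higher row only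
  the box in that column is affected: its leg grows by one, and its arm and leg are determined by
  the distance of the two row ends.\<close>

lemma row_hook_above:
  assumes "\<alpha> > 0" "antimono f" and add: "r < N" "f r < f (r - 1)" "i < r"
  shows "row_hook \<alpha> N (f(r := Suc (f r))) i = row_hook \<alpha> N f i *
    (((row_end \<alpha> f r - row_end \<alpha> f i) * (row_end \<alpha> f r + \<alpha> - row_end \<alpha> f i - 1)) /
     ((row_end \<alpha> f r - row_end \<alpha> f i + 1) * (row_end \<alpha> f r + \<alpha> - row_end \<alpha> f i)))"
proof -
  define c where "c = f r"
  let ?f = "f(r := Suc c)"
  have "f (r - 1) \<le> f i" using assms by (simp add: antimonoD)
  then have ci: "c < f i" using add by (simp add: c_def)
  have leg: "leg_length N ?f i j = leg_length N f i j" if "j \<noteq> c" for j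
    using that by (auto simp: leg_length_def c_def intro!: arg_cong[where f = card])
  have above: "c < f k" if "k < r" for k
  proof -
    have "f (r - 1) \<le> f k" using that assms(2) by (simp add: antimonoD)
    then show ?thesis using add by (simp add: c_def)
  qed
  have below: "f k \<le> c" if "r \<le> k" for k
    unfolding c_def using assms(2) that by (simp add: antimonoD)
  have longer_iff: "c < f k \<longleftrightarrow> k < r" for k
    using above[of k] below[of k] by (cases "k < r") auto
  have "{k \<in> {i<..<N}. c < f k} = {i<..<r}"
    using add by (auto simp: longer_iff)
  then have lc: "leg_length N f i c = r - Suc i" by (simp add: leg_length_def)
  have "{k \<in> {i<..<N}. c < ?f k} = {i<..<Suc r}"
    using add by (auto simp: longer_iff less_Suc_eq split: if_splits)
  then have lc': "leg_length N ?f i c = r - i" by (simp add: leg_length_def)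
  let ?t = "\<lambda>f j. (\<alpha> * real (f i - Suc j) + real (leg_length N f i j) + 1) *
     (\<alpha> * real (f i - Suc j) + real (leg_length N f i j) + \<alpha>)"
  have split: "row_hook \<alpha> N h i = ?t h c * (\<Prod>j\<in>{..<f i} - {c}. ?t h j)" if "h i = f i" for h
    unfolding row_hook_def that using ci by (intro prod.remove) auto
  have rest: "(\<Prod>j\<in>{..<f i} - {c}. ?t ?f j) = (\<Prod>j\<in>{..<f i} - {c}. ?t f j)"
    using add leg by (intro prod.cong) auto
  define D where "D = row_end \<alpha> f i - row_end \<alpha> f r"
  have arm: "\<alpha> * real (f i - Suc c) = D - \<alpha> - real (r - i)"
    using ci add by (simp add: D_def row_end_def of_nat_diff c_def algebra_simps)
  have "\<alpha> * real (f i - Suc c) \<ge> 0" using assms by simp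
  moreover have "real (r - i) \<ge> 1" using add by simp
  ultimately have D: "D - \<alpha> \<ge> 1" using arm by linarith
  have t: "?t f c = (D - \<alpha>) * (D - 1)" and t': "?t ?f c = (D - \<alpha> + 1) * D"
    using add by (simp_all add: arm lc lc' of_nat_diff Suc_le_eq)
  have "?t ?f c = ?t f c * (((- D) * (- D + \<alpha> - 1)) / ((- D + 1) * (- D + \<alpha>)))"
    unfolding t t' using D assms(1) by (simp add: divide_simps) (simp add: algebra_simps)
  then have "row_hook \<alpha> N ?f i = row_hook \<alpha> N f i * (((- D) * (- D + \<alpha> - 1)) / ((- D + 1) * (- D + \<alpha>)))"
    using split[of f] split[of ?f] add rest by simp
  then show ?thesis by (simp add: D_def c_def algebra_simps)
qed

text \<open>In row \<open>r\<close> itself all legs stay, every old arm grows by one, and a box with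
  arm and leg 0 is appended, contributing \<open>1 * \<alpha>\<close>. The quotient of new by old
  factors telescopes on each block of columns with equal leg.\<close>

lemma row_hook_at:
  assumes \<alpha>: "\<alpha> > 0" and f: "antimono f" and r: "r < N"
  shows "row_hook \<alpha> N (f(r := Suc (f r))) r = row_hook \<alpha> N f r *
    ((row_end \<alpha> f r + real N) * (row_end \<alpha> f r + \<alpha> - 1 + real N)) *
    (\<Prod>k\<in>{r<..<N}. ((row_end \<alpha> f r - row_end \<alpha> f k) * (row_end \<alpha> f r + \<alpha> - row_end \<alpha> f k - 1)) /
     ((row_end \<alpha> f r - row_end \<alpha> f k + 1) * (row_end \<alpha> f r + \<alpha> - row_end \<alpha> f k)))"
proof -
  define c where "c = f r"
  let ?f = "f(r := Suc c)" and ?x = "row_end \<alpha> f"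
  have below: "f k \<le> c" if "r < k" for k
    unfolding c_def using f that by (simp add: antimonoD)
  have leg: "leg_length N ?f r j = leg_length N f r j" for j
    by (auto simp: leg_length_def intro!: arg_cong[where f = card])
  have leg0: "leg_length N f r c = 0"
    using below by (auto simp: leg_length_def not_less)
  \<comment> \<open>\<open>g j\<close> and \<open>g' j\<close> are the two factors of column
    \<open>j\<close> in the lengthened row; with \<open>Suc j\<close> in place of \<open>j\<close>
    they are those of the old row.\<close>
  define g where "g j l = \<alpha> * (real c - real j) + real l + 1" for j l :: nat
  define g' where "g' j l = \<alpha> * (real c - real j) + real l + \<alpha>" for j l :: nat
  have g: "g j l > 0" "g' j l > 0" if "j \<le> c" for j l
    using that \<alpha> by (auto simp: g_def g'_def intro!: add_nonneg_pos add_nonneg_nonneg)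
  let ?l = "leg_length N f r"
  have "row_hook \<alpha> N ?f r = (\<Prod>j<Suc c. g j (?l j) * g' j (?l j))"
    by (auto simp: row_hook_def leg g_def g'_def of_nat_diff intro!: prod.cong)
  also have "\<dots> = \<alpha> * (\<Prod>j<c. g j (?l j) * g' j (?l j))"
    by (simp add: leg0 g_def g'_def)
  finally have new: "row_hook \<alpha> N ?f r = \<alpha> * (\<Prod>j<c. g j (?l j) * g' j (?l j))" .
  have old: "row_hook \<alpha> N f r = (\<Prod>j<c. g (Suc j) (?l j) * g' (Suc j) (?l j))"
    by (auto simp: row_hook_def c_def g_def g'_def of_nat_diff Suc_le_eq intro!: prod.cong)
  have "(\<Prod>j<c. g j (?l j) * g' j (?l j)) = row_hook \<alpha> N f r *
      ((\<Prod>j<c. g j (?l j) / g (Suc j) (?l j)) * (\<Prod>j<c. g' j (?l j) / g' (Suc j) (?l j)))"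
    unfolding old prod.distrib[symmetric]
  proof (rule prod.cong[OF refl])
    fix j assume "j \<in> {..<c}"
    then have "g (Suc j) (?l j) > 0" "g' (Suc j) (?l j) > 0" using g by auto
    then show "g j (?l j) * g' j (?l j) = g (Suc j) (?l j) * g' (Suc j) (?l j) *
        (g j (?l j) / g (Suc j) (?l j) * (g' j (?l j) / g' (Suc j) (?l j)))"
      by simp
  qed
  also have "(\<Prod>j<c. g j (?l j) / g (Suc j) (?l j)) =
      g 0 (N - Suc r) / g c 0 * (\<Prod>k\<in>{r<..<N}. g (f k) (k - Suc r) / g (f k) (k - r))"
    using r g below by (intro row_prod_telescope[OF f]) (auto simp: less_imp_neq[symmetric])
  also have "(\<Prod>j<c. g' j (?l j) / g' (Suc j) (?l j)) =
      g' 0 (N - Suc r) / g' c 0 * (\<Prod>k\<in>{r<..<N}. g' (f k) (k - Suc r) / g' (f k) (k - r))"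
    using r g below by (intro row_prod_telescope[OF f]) (auto simp: less_imp_neq[symmetric])
  also have "(\<Prod>k\<in>{r<..<N}. g (f k) (k - Suc r) / g (f k) (k - r)) =
      (\<Prod>k\<in>{r<..<N}. (?x r - ?x k) / (?x r - ?x k + 1))"
    by (auto simp: g_def row_end_def c_def of_nat_diff Suc_le_eq algebra_simps intro!: prod.cong)
  also have "(\<Prod>k\<in>{r<..<N}. g' (f k) (k - Suc r) / g' (f k) (k - r)) =
      (\<Prod>k\<in>{r<..<N}. (?x r + \<alpha> - ?x k - 1) / (?x r + \<alpha> - ?x k))"
    by (auto simp: g'_def row_end_def c_def of_nat_diff Suc_le_eq algebra_simps intro!: prod.cong)
  finally have "(\<Prod>j<c. g j (?l j) * g' j (?l j)) = row_hook \<alpha> N f r *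
      ((?x r + real N) * ((?x r + \<alpha> - 1 + real N) / \<alpha>)) *
      ((\<Prod>k\<in>{r<..<N}. (?x r - ?x k) / (?x r - ?x k + 1)) *
       (\<Prod>k\<in>{r<..<N}. (?x r + \<alpha> - ?x k - 1) / (?x r + \<alpha> - ?x k)))"
    using r by (simp add: g_def g'_def row_end_def c_def of_nat_diff Suc_le_eq algebra_simps)
  then show ?thesis
    unfolding new[unfolded c_def] prod.distrib[symmetric] times_divide_times_eq
    using \<alpha> by (simp add: c_def)
qed

text \<open>Rows above and below \<open>r\<close> contribute the same expression \<open>?q\<close>.
  Half of it cancels the factors of the up weight; the other half consists of the factors of the
  down weight, because the lengthened row ends at \<open>row_end \<alpha> f r + \<alpha>\<close>. In
  terms of \<open>jack\<close> this is detailed balance.\<close>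

lemma hook_product_ratio:
  assumes \<alpha>: "\<alpha> > 0" and f: "antimono f" and r: "r < N" and add: "r = 0 \<or> f r < f (r - 1)"
  shows "hook_product \<alpha> N (f(r := Suc (f r))) * up_weight \<alpha> N f r =
    hook_product \<alpha> N f * down_weight \<alpha> N (f(r := Suc (f r))) r"
proof -
  let ?x = "row_end \<alpha> f" and ?f = "f(r := Suc (f r))"
  let ?q = "\<lambda>i. ((?x r - ?x i) * (?x r + \<alpha> - ?x i - 1)) / ((?x r - ?x i + 1) * (?x r + \<alpha> - ?x i))"
  let ?s = "(?x r + real N) * (?x r + \<alpha> - 1 + real N)"
  have above: "row_hook \<alpha> N ?f i = row_hook \<alpha> N f i * ?q i" if "i < r" for i
    using that add r by (intro row_hook_above[OF \<alpha> f]) auto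
  have below: "row_hook \<alpha> N ?f i = row_hook \<alpha> N f i" if "r < i" for i
    using that by (auto simp: row_hook_def leg_length_def intro!: prod.cong arg_cong2[where f = times]
        arg_cong2[where f = plus] arg_cong[where f = card] arg_cong[where f = real])
  have I: "{..<N} = insert r ({..<r} \<union> {r<..<N})" "{..<N} - {r} = {..<r} \<union> {r<..<N}"
    using r by auto
  have minus_r: "prod F ({..<N} - {r}) = prod F {..<r} * prod F {r<..<N}" for F :: "nat \<Rightarrow> real"
    unfolding I(2) by (rule prod.union_disjoint) auto
  have all: "prod F {..<N} = prod F {..<r} * F r * prod F {r<..<N}" for F :: "nat \<Rightarrow> real"
    using r prod.remove[of "{..<N}" r F] by (simp add: minus_r)
  have "hook_product \<alpha> N ?f = (\<Prod>i<r. row_hook \<alpha> N ?f i) * row_hook \<alpha> N ?f r *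
      (\<Prod>i\<in>{r<..<N}. row_hook \<alpha> N ?f i)"
    unfolding hook_product_def by (rule all)
  also have "\<dots> = (\<Prod>i<r. row_hook \<alpha> N f i * ?q i) * (row_hook \<alpha> N f r * ?s * (\<Prod>k\<in>{r<..<N}. ?q k)) *
      (\<Prod>i\<in>{r<..<N}. row_hook \<alpha> N f i)"
    unfolding row_hook_at[OF \<alpha> f r] using above below by (simp cong: prod.cong_simp)
  also have "\<dots> = hook_product \<alpha> N f * ?s * (\<Prod>i\<in>{..<N} - {r}. ?q i)"
    unfolding hook_product_def all minus_r prod.distrib by (simp only: mult_ac)
  finally have ratio: "hook_product \<alpha> N ?f = hook_product \<alpha> N f * ?s * (\<Prod>i\<in>{..<N} - {r}. ?q i)" .
  have "?q i * ((?x r - ?x i + 1) / (?x r - ?x i)) = (?x r + \<alpha> - ?x i - 1) / (?x r + \<alpha> - ?x i)"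
    if i: "i \<in> {..<N} - {r}" for i
  proof -
    \<comment> \<open>Above row \<open>r\<close>, addability makes the gap of the row ends strictly
      larger than 1, which keeps \<open>?x r - ?x i + 1\<close> away from 0.\<close>
    have "?x r - ?x i + 1 \<noteq> 0 \<and> ?x r - ?x i \<noteq> 0"
    proof (cases "i < r")
      case True
      then have "i \<le> r - 1" by simp
      then have "f r < f i" using add True antimonoD[OF f, of i "r - 1"] by auto
      then have "\<alpha> * real (f r) < \<alpha> * real (f i)" using \<alpha> by simp
      then show ?thesis using True by (simp add: row_end_def)
    next
      case False
      then show ?thesis using i row_end_diff[OF \<alpha> f, of r i] by auto
    qed
    then show ?thesis by (simp add: divide_simps)
  qed
  then have "(\<Prod>i\<in>{..<N} - {r}. ?q i) * (\<Prod>i\<in>{..<N} - {r}. (?x r - ?x i + 1) / (?x r - ?x i)) =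
      (\<Prod>i\<in>{..<N} - {r}. (?x r + \<alpha> - ?x i - 1) / (?x r + \<alpha> - ?x i))"
    unfolding prod.distrib[symmetric] by (intro prod.cong) auto
  moreover have "down_weight \<alpha> N ?f r = (?x r + \<alpha> - 1 + real N) *
      (\<Prod>i\<in>{..<N} - {r}. (?x r + \<alpha> - ?x i - 1) / (?x r + \<alpha> - ?x i))"
    unfolding down_weight_def
    by (intro arg_cong2[where f = times] prod.cong) (auto simp: row_end_def algebra_simps)
  moreover have "?x r + real N > 0" by (rule row_end_pos[OF \<alpha> r])
  ultimately show ?thesis
    unfolding ratio up_weight_def by (simp add: mult.assoc)
qed

section \<open>The growth process\<close>

definition jack :: "real \<Rightarrow> nat \<Rightarrow> nat \<Rightarrow> (nat \<Rightarrow> nat) \<Rightarrow> real" where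
  "jack \<alpha> N n f = \<alpha> ^ n * fact n / hook_product \<alpha> N f"

definition jack_mean :: "real \<Rightarrow> nat \<Rightarrow> nat \<Rightarrow> ((nat \<Rightarrow> nat) \<Rightarrow> real) \<Rightarrow> real" where
  "jack_mean \<alpha> N n F = (\<Sum>f\<in>row_functions N n. jack \<alpha> N n f * F f)"

lemma hook_product_pos: "\<alpha> > 0 \<Longrightarrow> hook_product \<alpha> N f > 0"
  unfolding hook_product_def row_hook_def
  by (intro prod_pos ballI mult_pos_pos add_nonneg_pos add_nonneg_nonneg) auto

lemma jack_pos: "\<alpha> > 0 \<Longrightarrow> jack \<alpha> N n f > 0"
  by (simp add: jack_def hook_product_pos)

lemma row_functionsD:
  assumes "f \<in> row_functions N n"
  shows "antimono f" "N \<le> i \<Longrightarrow> f i = 0" "(\<Sum>i<N. f i) = n"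
  using assms by (auto simp: row_functions_def)

lemma row_functions_last:
  assumes "f \<in> row_functions (Suc M) n" "n \<le> M"
  shows "f M = 0"
proof (rule ccontr)
  assume "f M \<noteq> 0"
  then have "1 \<le> f i" if "i < Suc M" for i
    using antimonoD[OF row_functionsD(1)[OF assms(1)], of i M] that by auto
  then have "(\<Sum>i<Suc M. 1) \<le> (\<Sum>i<Suc M. f i)" by (intro sum_mono) auto
  then show False using row_functionsD(3)[OF assms(1)] assms(2) by simp
qed

lemma finite_row_functions: "finite (row_functions N n)"
proof (rule finite_subset)
  show "row_functions N n \<subseteq> {f. \<forall>i. (i \<in> {..<N} \<longrightarrow> f i \<in> {..n}) \<and> (i \<notin> {..<N} \<longrightarrow> f i = 0)}"
    by (auto simp: row_functions_def intro: member_le_sum[where f = "f" for f :: "nat \<Rightarrow> nat"])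
  show "finite {f. \<forall>i. (i \<in> {..<N} \<longrightarrow> f i \<in> {..n}) \<and> (i \<notin> {..<N} \<longrightarrow> f i = (0::nat))}"
    by (rule finite_set_of_finite_funs) auto
qed

lemma sum_fun_upd:
  fixes f :: "nat \<Rightarrow> nat" and F :: "nat \<Rightarrow> nat \<Rightarrow> 'b :: comm_monoid_add"
  assumes "r < N"
  shows "(\<Sum>i<N. F i ((f(r := c)) i)) = F r c + (\<Sum>i\<in>{..<N} - {r}. F i (f i))"
  using assms by (subst sum.remove[of _ r]) auto

lemma add_box_mem:
  assumes f: "f \<in> row_functions N n" and r: "r < N" and add: "r = 0 \<or> f r < f (r - 1)"
  shows "f(r := Suc (f r)) \<in> row_functions N (Suc n)"
proof -
  note anti = row_functionsD(1)[OF f]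
  have "antimono (f(r := Suc (f r)))"
  proof (rule antimonoI)
    fix i j :: nat assume "i \<le> j"
    moreover have "f r < f i" if "i < r"
    proof -
      have "i \<le> r - 1" using that by simp
      then show ?thesis using antimonoD[OF anti, of i "r - 1"] add that by auto
    qed
    ultimately show "(f(r := Suc (f r))) j \<le> (f(r := Suc (f r))) i"
      using antimonoD[OF anti, of i j] by (auto simp: Suc_le_eq)
  qed
  moreover have "(\<Sum>i<N. (f(r := Suc (f r))) i) = Suc n"
    using sum_fun_upd[OF r, of "\<lambda>_ x. x" f "Suc (f r)"] sum_fun_upd[OF r, of "\<lambda>_ x. x" f "f r"]
      row_functionsD(3)[OF f] by simp
  ultimately show ?thesis using f r by (auto simp: row_functions_def)
qed

lemma remove_box_mem:
  assumes f: "f \<in> row_functions N (Suc n)" and r: "r < N" and rem: "f (Suc r) < f r"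
  shows "f(r := f r - 1) \<in> row_functions N n"
proof -
  note anti = row_functionsD(1)[OF f]
  have "antimono (f(r := f r - 1))"
  proof (rule antimonoI)
    fix i j :: nat assume "i \<le> j"
    then show "(f(r := f r - 1)) j \<le> (f(r := f r - 1)) i"
      using antimonoD[OF anti, of i j] antimonoD[OF anti, of "Suc r" j] rem
      by (auto split: if_splits)
  qed
  moreover have "(\<Sum>i<N. (f(r := f r - 1)) i) = n"
    using sum_fun_upd[OF r, of "\<lambda>_ x. x" f "f r - 1"] sum_fun_upd[OF r, of "\<lambda>_ x. x" f "f r"]
      row_functionsD(3)[OF f] rem by simp
  ultimately show ?thesis using f r by (auto simp: row_functions_def)
qed

text \<open>Distinct row ends differ by at least 1, so adding 1 to a difference never reverses its
  sign.\<close>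

lemma up_weight_nonneg:
  assumes "\<alpha> > 0" "antimono f" "i < N"
  shows "up_weight \<alpha> N f i \<ge> 0"
  unfolding up_weight_def
proof (rule divide_nonneg_pos[OF prod_nonneg])
  fix j assume j: "j \<in> {..<N} - {i}"
  show "0 \<le> (row_end \<alpha> f i - row_end \<alpha> f j + 1) / (row_end \<alpha> f i - row_end \<alpha> f j)"
  proof (cases "i < j")
    case True
    then show ?thesis using row_end_diff[OF assms(1,2) True] by (intro divide_nonneg_pos) auto
  next
    case False
    then have "j < i" using j by auto
    then show ?thesis using row_end_diff[OF assms(1,2), of j i] by (intro divide_nonpos_neg) auto
  qed
qed (rule row_end_pos[OF assms(1,3)])

lemma up_weight_eq_0:
  assumes "r < N" "r \<noteq> 0" "f r = f (r - 1)"
  shows "up_weight \<alpha> N f r = 0"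
proof -
  have "r - 1 \<in> {..<N} - {r}" "row_end \<alpha> f r - row_end \<alpha> f (r - 1) + 1 = 0"
    using assms by (auto simp: row_end_def of_nat_diff)
  then show ?thesis unfolding up_weight_def by (auto intro!: prod_zero)
qed

lemma down_weight_eq_0:
  assumes "r < N" "f r = f (Suc r)" "f N = 0"
  shows "down_weight \<alpha> N f r = 0"
proof (cases "Suc r < N")
  case True
  then have "Suc r \<in> {..<N} - {r}" "row_end \<alpha> f r - row_end \<alpha> f (Suc r) - 1 = 0"
    using assms by (auto simp: row_end_def)
  then show ?thesis unfolding down_weight_def by (auto intro!: prod_zero)
next
  case False
  \<comment> \<open>In the last row it is the prefactor that vanishes, since the row end is
    \<open>1 - N\<close>.\<close>
  then have "Suc r = N" using assms by simp
  then show ?thesis using assms by (auto simp: down_weight_def row_end_def)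
qed

text \<open>Detailed balance: adding a box to a random partition of size \<open>n\<close> with the up weights, and
  removing a box from one of size \<open>n + 1\<close> with the normalised down weights, give the same law of
  the pair.\<close>

lemma up_down_coupling:
  assumes \<alpha>: "\<alpha> > 0"
  shows "jack_mean \<alpha> N (Suc n) (\<lambda>f. \<Sum>r<N. down_weight \<alpha> N f r * G f r) =
    \<alpha> * real (Suc n) * jack_mean \<alpha> N n (\<lambda>f. \<Sum>r<N. up_weight \<alpha> N f r * G (f(r := Suc (f r))) r)"
proof -
  let ?R = "row_functions N" and ?add = "\<lambda>f r. f(r := Suc (f r))"
  define A where "A = {p \<in> ?R (Suc n) \<times> {..<N}. fst p (Suc (snd p)) < fst p (snd p)}"
  define B where "B = {p \<in> ?R n \<times> {..<N}. snd p = 0 \<or> fst p (snd p) < fst p (snd p - 1)}"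
  let ?S = "\<lambda>p. jack \<alpha> N (Suc n) (fst p) * (down_weight \<alpha> N (fst p) (snd p) * G (fst p) (snd p))"
  let ?T = "\<lambda>p. \<alpha> * real (Suc n) * (jack \<alpha> N n (fst p) *
      (up_weight \<alpha> N (fst p) (snd p) * G (?add (fst p) (snd p)) (snd p)))"
  have "jack_mean \<alpha> N (Suc n) (\<lambda>f. \<Sum>r<N. down_weight \<alpha> N f r * G f r) = sum ?S (?R (Suc n) \<times> {..<N})"
    by (simp add: jack_mean_def sum_distrib_left sum.cartesian_product split_def)
  \<comment> \<open>The weights vanish away from the corners. On the remaining pairs
    \<open>A\<close> and \<open>B\<close>, removing and adding a box are mutually inverse.\<close>
  also have "\<dots> = sum ?S A"
  proof (rule sum.mono_neutral_right)
    show "finite (?R (Suc n) \<times> {..<N})" by (simp add: finite_row_functions)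
    show "A \<subseteq> ?R (Suc n) \<times> {..<N}" by (auto simp: A_def)
    show "\<forall>p\<in>?R (Suc n) \<times> {..<N} - A. ?S p = 0"
    proof
      fix p assume p: "p \<in> ?R (Suc n) \<times> {..<N} - A"
      then have f: "fst p \<in> ?R (Suc n)" by auto
      have "fst p (Suc (snd p)) \<le> fst p (snd p)"
        by (rule antimonoD[OF row_functionsD(1)[OF f]]) simp
      then have "fst p (snd p) = fst p (Suc (snd p))" using p by (auto simp: A_def)
      then show "?S p = 0"
        using p down_weight_eq_0[of "snd p" N "fst p"] row_functionsD(2)[OF f, of N] by auto
    qed
  qed
  also have "sum ?S A = sum ?T B"
  proof (rule sum.reindex_bij_witness[symmetric, where i = "\<lambda>p. ((fst p)(snd p := fst p (snd p) - 1), snd p)"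
        and j = "\<lambda>p. (?add (fst p) (snd p), snd p)"])
    fix p assume p: "p \<in> B"
    obtain f r where fr: "p = (f, r)" by (cases p)
    have f: "f \<in> ?R n" "r < N" "r = 0 \<or> f r < f (r - 1)" using p by (auto simp: B_def fr)
    note anti = row_functionsD(1)[OF f(1)]
    show "(\<lambda>p. ((fst p)(snd p := fst p (snd p) - 1), snd p)) (?add (fst p) (snd p), snd p) = p"
      by (simp add: fr)
    have "f (Suc r) \<le> f r" by (rule antimonoD[OF anti]) simp
    then show "(?add (fst p) (snd p), snd p) \<in> A"
      using add_box_mem[OF f] f by (simp add: A_def fr)
    \<comment> \<open>The factor \<open>\<alpha> * real (Suc n)\<close> is the quotient of the
      normalisations \<open>\<alpha> ^ n * fact n\<close> for the two sizes; the hook products are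
      compared by \<open>hook_product_ratio\<close>.\<close>
    have "jack \<alpha> N (Suc n) (?add f r) * down_weight \<alpha> N (?add f r) r =
        \<alpha> * real (Suc n) * (jack \<alpha> N n f * up_weight \<alpha> N f r)"
      using hook_product_ratio[OF \<alpha> anti f(2,3)] hook_product_pos[OF \<alpha>, of N f]
        hook_product_pos[OF \<alpha>, of N "?add f r"]
      by (simp add: jack_def field_simps)
    then show "?S (?add (fst p) (snd p), snd p) = ?T p"
      by (simp add: fr mult.assoc[symmetric])
  next
    fix p assume p: "p \<in> A"
    obtain f r where fr: "p = (f, r)" by (cases p)
    have f: "f \<in> ?R (Suc n)" "r < N" "f (Suc r) < f r" using p by (auto simp: A_def fr)
    note anti = row_functionsD(1)[OF f(1)]
    show "(\<lambda>p. (?add (fst p) (snd p), snd p)) ((fst p)(snd p := fst p (snd p) - 1), snd p) = p"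
      using f(3) by (simp add: fr)
    have "f r \<le> f (r - 1)" by (rule antimonoD[OF anti]) simp
    then show "((fst p)(snd p := fst p (snd p) - 1), snd p) \<in> B"
      using remove_box_mem[OF f] f by (auto simp: B_def fr)
  qed
  also have "sum ?T B = sum ?T (?R n \<times> {..<N})"
  proof (rule sum.mono_neutral_left)
    show "finite (?R n \<times> {..<N})" by (simp add: finite_row_functions)
    show "B \<subseteq> ?R n \<times> {..<N}" by (auto simp: B_def)
    show "\<forall>p\<in>?R n \<times> {..<N} - B. ?T p = 0"
    proof
      fix p assume p: "p \<in> ?R n \<times> {..<N} - B"
      then have f: "fst p \<in> ?R n" by auto
      have "fst p (snd p) \<le> fst p (snd p - 1)"
        by (rule antimonoD[OF row_functionsD(1)[OF f]]) simp
      then show "?T p = 0"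
        using p up_weight_eq_0[of "snd p" N "fst p"] by (auto simp: B_def)
    qed
  qed
  finally show ?thesis
    by (simp add: jack_mean_def sum_distrib_left sum.cartesian_product split_def mult.assoc)
qed

lemma box_sum_0: "f \<in> row_functions N n \<Longrightarrow> box_sum \<alpha> N 0 f = real n"
  using row_functionsD(3)[of f N n] by (simp add: box_sum_def flip: of_nat_sum)

lemma box_sum_add_box:
  assumes "r < N"
  shows "box_sum \<alpha> N k (f(r := Suc (f r))) = box_sum \<alpha> N k f + row_end \<alpha> f r ^ k"
  using sum_fun_upd[OF assms, of "\<lambda>i m. \<Sum>j<m. (\<alpha> * real j - real i) ^ k" f "Suc (f r)"]
    sum_fun_upd[OF assms, of "\<lambda>i m. \<Sum>j<m. (\<alpha> * real j - real i) ^ k" f "f r"]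
  by (simp add: box_sum_def row_end_def)

lemma jack_mean_cong:
  "(\<And>f. f \<in> row_functions N n \<Longrightarrow> F f = G f) \<Longrightarrow> jack_mean \<alpha> N n F = jack_mean \<alpha> N n G"
  by (simp add: jack_mean_def)

lemma jack_mean_linear:
  "jack_mean \<alpha> N n (\<lambda>f. F f + G f) = jack_mean \<alpha> N n F + jack_mean \<alpha> N n G"
  "jack_mean \<alpha> N n (\<lambda>f. F f - G f) = jack_mean \<alpha> N n F - jack_mean \<alpha> N n G"
  "jack_mean \<alpha> N n (\<lambda>f. c * F f) = c * jack_mean \<alpha> N n F"
  by (simp_all add: jack_mean_def sum.distrib sum_subtractf sum_distrib_left algebra_simps)

text \<open>A test function that ignores the removed box sees only the total
  \<open>\<alpha> * real (Suc n)\<close> of the down weights, which cancels the factor in the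
  coupling.\<close>

lemma jack_mean_grow:
  assumes \<alpha>: "\<alpha> > 0"
  shows "jack_mean \<alpha> N (Suc n) F =
    jack_mean \<alpha> N n (\<lambda>f. \<Sum>r<N. up_weight \<alpha> N f r * F (f(r := Suc (f r))))"
proof -
  have "(\<Sum>r<N. down_weight \<alpha> N f r * F f) = \<alpha> * real (Suc n) * F f" if f: "f \<in> row_functions N (Suc n)" for f
    using down_weight_moments(1)[OF \<alpha> row_functionsD(1)[OF f], of N] box_sum_0[OF f, of \<alpha>]
    by (simp add: power_sum_eq sum_distrib_right[symmetric])
  then have "\<alpha> * real (Suc n) * jack_mean \<alpha> N (Suc n) F =
      jack_mean \<alpha> N (Suc n) (\<lambda>f. \<Sum>r<N. down_weight \<alpha> N f r * F f)"
    unfolding jack_mean_linear(3)[symmetric] by (intro jack_mean_cong) simp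
  also have "\<dots> = \<alpha> * real (Suc n) *
      jack_mean \<alpha> N n (\<lambda>f. \<Sum>r<N. up_weight \<alpha> N f r * F (f(r := Suc (f r))))"
    by (rule up_down_coupling[OF \<alpha>])
  finally show ?thesis using \<alpha> by simp
qed

text \<open>The coupling for a test function that does see the box, through its content. On the down
  side the terms in the number of boxes cancel, and the content averages to a multiple of the
  content sum.\<close>

lemma jack_mean_content_bias:
  assumes \<alpha>: "\<alpha> > 0"
  shows "2 / real (Suc n) * jack_mean \<alpha> N (Suc n) (\<lambda>f. box_sum \<alpha> N 1 f * \<phi> (box_sum \<alpha> N 1 f)) =
    jack_mean \<alpha> N n (\<lambda>f. \<Sum>r<N. up_weight \<alpha> N f r *
      (row_end \<alpha> f r * \<phi> (box_sum \<alpha> N 1 f + row_end \<alpha> f r)))"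
proof -
  let ?B = "box_sum \<alpha> N 1"
  \<comment> \<open>In the larger partition \<open>row_end \<alpha> f r\<close> lies one box beyond
    row \<open>r\<close>; subtracting \<open>\<alpha>\<close> gives the content of the box to be
    removed.\<close>
  let ?G = "\<lambda>f r. (row_end \<alpha> f r - \<alpha>) * \<phi> (?B f)"
  have "(\<Sum>r<N. down_weight \<alpha> N f r * ?G f r) = 2 * \<alpha> * (?B f * \<phi> (?B f))"
    if f: "f \<in> row_functions N (Suc n)" for f
  proof -
    note anti = row_functionsD(1)[OF f]
    have "(\<Sum>r<N. down_weight \<alpha> N f r * ?G f r) =
        ((\<Sum>r<N. down_weight \<alpha> N f r * (row_end \<alpha> f r - 1)) + (1 - \<alpha>) * (\<Sum>r<N. down_weight \<alpha> N f r)) * \<phi> (?B f)"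
      unfolding sum_distrib_left sum_distrib_right sum.distrib[symmetric]
      by (intro sum.cong) (auto simp: algebra_simps)
    also have "\<dots> = 2 * \<alpha> * (?B f * \<phi> (?B f))"
      unfolding down_weight_moments[OF \<alpha> anti] power_sum_eq by (simp add: field_simps)
    finally show ?thesis .
  qed
  then have "2 * \<alpha> * jack_mean \<alpha> N (Suc n) (\<lambda>f. ?B f * \<phi> (?B f)) =
      jack_mean \<alpha> N (Suc n) (\<lambda>f. \<Sum>r<N. down_weight \<alpha> N f r * ?G f r)"
    unfolding jack_mean_linear(3)[symmetric] by (intro jack_mean_cong) simp
  also have "\<dots> = \<alpha> * real (Suc n) *
      jack_mean \<alpha> N n (\<lambda>f. \<Sum>r<N. up_weight \<alpha> N f r * ?G (f(r := Suc (f r))) r)"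
    by (rule up_down_coupling[OF \<alpha>])
  also have "jack_mean \<alpha> N n (\<lambda>f. \<Sum>r<N. up_weight \<alpha> N f r * ?G (f(r := Suc (f r))) r) =
      jack_mean \<alpha> N n (\<lambda>f. \<Sum>r<N. up_weight \<alpha> N f r * (row_end \<alpha> f r * \<phi> (?B f + row_end \<alpha> f r)))"
  proof (intro jack_mean_cong sum.cong refl)
    fix f r assume "r \<in> {..<N}"
    then have "box_sum \<alpha> N 1 (f(r := Suc (f r))) = ?B f + row_end \<alpha> f r"
      by (simp add: box_sum_add_box)
    moreover have "row_end \<alpha> (f(r := Suc (f r))) r - \<alpha> = row_end \<alpha> f r"
      by (simp add: row_end_def algebra_simps)
    ultimately show "up_weight \<alpha> N f r * ?G (f(r := Suc (f r))) r =
        up_weight \<alpha> N f r * (row_end \<alpha> f r * \<phi> (?B f + row_end \<alpha> f r))"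
      by simp
  qed
  finally have "2 * jack_mean \<alpha> N (Suc n) (\<lambda>f. ?B f * \<phi> (?B f)) = real (Suc n) *
      jack_mean \<alpha> N n (\<lambda>f. \<Sum>r<N. up_weight \<alpha> N f r * (row_end \<alpha> f r * \<phi> (?B f + row_end \<alpha> f r)))"
    using \<alpha> by (simp only: mult.assoc mult.left_commute[of _ \<alpha>] mult_cancel_left) simp
  then show ?thesis by (simp add: nonzero_divide_eq_eq mult.commute del: of_nat_Suc)
qed

lemma up_weight_row_functions:
  assumes \<alpha>: "\<alpha> > 0" and f: "f \<in> row_functions N n" and "n < N"
  shows "(\<Sum>r<N. up_weight \<alpha> N f r) = 1"
    and "(\<Sum>r<N. up_weight \<alpha> N f r * row_end \<alpha> f r) = 0"
    and "(\<Sum>r<N. up_weight \<alpha> N f r * row_end \<alpha> f r ^ 2) = \<alpha> * real n"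
    and "(\<Sum>r<N. up_weight \<alpha> N f r * row_end \<alpha> f r ^ 4) = 3 * \<alpha> * box_sum \<alpha> N 2 f
       + 3 * \<alpha> * (\<alpha> - 1) * box_sum \<alpha> N 1 f + (\<alpha> ^ 3 - 3 / 2 * \<alpha>\<^sup>2 + \<alpha>) * real n + (\<alpha> * real n)\<^sup>2 / 2"
proof -
  obtain M where N: "N = Suc M" using \<open>n < N\<close> by (cases N) auto
  have "f M = 0" using row_functions_last[of f M n] f \<open>n < N\<close> by (simp add: N)
  note mom = up_weight_moments[OF \<alpha> row_functionsD(1)[OF f] this, folded N, unfolded power_sum_eq
      box_sum_0[OF f]]
  show "(\<Sum>r<N. up_weight \<alpha> N f r) = 1" "(\<Sum>r<N. up_weight \<alpha> N f r * row_end \<alpha> f r) = 0"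
    "(\<Sum>r<N. up_weight \<alpha> N f r * row_end \<alpha> f r ^ 2) = \<alpha> * real n"
    using mom(1-3) by simp_all
  show "(\<Sum>r<N. up_weight \<alpha> N f r * row_end \<alpha> f r ^ 4) = 3 * \<alpha> * box_sum \<alpha> N 2 f
       + 3 * \<alpha> * (\<alpha> - 1) * box_sum \<alpha> N 1 f + (\<alpha> ^ 3 - 3 / 2 * \<alpha>\<^sup>2 + \<alpha>) * real n + (\<alpha> * real n)\<^sup>2 / 2"
    unfolding mom(4) by (simp add: field_simps power2_eq_square)
qed

text \<open>Induction along the growth with \<open>N\<close> fixed: the new box adds the
  \<open>k\<close>-th power of its content to \<open>box_sum \<alpha> N k\<close>, and the
  conditional mean of that power is 0 for \<open>k = 1\<close> and \<open>\<alpha> * real n\<close>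
  for \<open>k = 2\<close>. The first claim is the normalisation of the Jack measure.\<close>

lemma jack_mean_moments:
  assumes \<alpha>: "\<alpha> > 0" and "n < N"
  shows "jack_mean \<alpha> N n (\<lambda>f. 1) = 1" and "jack_mean \<alpha> N n (box_sum \<alpha> N 1) = 0"
    and "jack_mean \<alpha> N n (box_sum \<alpha> N 2) = \<alpha> * real n * (real n - 1) / 2"
proof -
  have *: "jack_mean \<alpha> N n (\<lambda>f. 1) = 1 \<and> jack_mean \<alpha> N n (box_sum \<alpha> N 1) = 0 \<and>
      jack_mean \<alpha> N n (box_sum \<alpha> N 2) = \<alpha> * real n * (real n - 1) / 2"
    using \<open>n < N\<close>
  proof (induction n)
    case 0
    have "row_functions N 0 = {\<lambda>_. 0}"
    proof (intro equalityI subsetI)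
      fix f assume f: "f \<in> row_functions N 0"
      have "f i = 0" for i
        using row_functionsD(2)[OF f, of i] row_functionsD(3)[OF f] by (cases "i < N") auto
      then show "f \<in> {\<lambda>_. 0}" by auto
    qed (auto simp: row_functions_def antimono_def)
    then show ?case
      by (simp add: jack_mean_def jack_def hook_product_def row_hook_def box_sum_def)
  next
    case (Suc n)
    have "jack_mean \<alpha> N (Suc n) (\<lambda>f. 1) = jack_mean \<alpha> N n (\<lambda>f. 1)"
      unfolding jack_mean_grow[OF \<alpha>, of N n] using Suc.prems
      by (intro jack_mean_cong) (simp add: up_weight_row_functions[OF \<alpha>])
    moreover have "jack_mean \<alpha> N (Suc n) (box_sum \<alpha> N k) =
        jack_mean \<alpha> N n (\<lambda>f. box_sum \<alpha> N k f + (\<Sum>r<N. up_weight \<alpha> N f r * row_end \<alpha> f r ^ k))" for k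
      unfolding jack_mean_grow[OF \<alpha>, of N n] using Suc.prems
      by (intro jack_mean_cong)
        (simp add: box_sum_add_box distrib_left sum.distrib sum_distrib_right[symmetric]
          up_weight_row_functions[OF \<alpha>])
    note grow = this
    have "jack_mean \<alpha> N (Suc n) (box_sum \<alpha> N 1) = jack_mean \<alpha> N n (box_sum \<alpha> N 1)"
      unfolding grow using Suc.prems
      by (intro jack_mean_cong) (simp add: up_weight_row_functions[OF \<alpha>])
    moreover have "jack_mean \<alpha> N (Suc n) (box_sum \<alpha> N 2) =
        jack_mean \<alpha> N n (\<lambda>f. box_sum \<alpha> N 2 f + \<alpha> * real n * 1)"
      unfolding grow using Suc.prems
      by (intro jack_mean_cong) (simp add: up_weight_row_functions[OF \<alpha>])
    ultimately show ?case
      using Suc unfolding jack_mean_linear by (simp add: field_simps)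
  qed
  then show "jack_mean \<alpha> N n (\<lambda>f. 1) = 1" "jack_mean \<alpha> N n (box_sum \<alpha> N 1) = 0"
    "jack_mean \<alpha> N n (box_sum \<alpha> N 2) = \<alpha> * real n * (real n - 1) / 2" by auto
qed

section \<open>The Stein equation\<close>

text \<open>Partial expectations under the normal law. The interval form serves the fundamental
  theorem of calculus; comparisons go through the indicator form
  \<open>below_int_eq\<close>.\<close>

definition below_int :: "(real \<Rightarrow> real) \<Rightarrow> real \<Rightarrow> real" where
  "below_int k w = (LBINT x=-\<infinity>..ereal w. k x * std_normal_density x)"

definition above_int :: "(real \<Rightarrow> real) \<Rightarrow> real \<Rightarrow> real" where
  "above_int k w = (LBINT x=ereal w..\<infinity>. k x * std_normal_density x)"

lemma below_int_eq: "below_int k w = (\<integral>x. indicator {..<w} x * (k x * std_normal_density x) \<partial>lborel)"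
  and above_int_eq: "above_int k w = (\<integral>x. indicator {w<..} x * (k x * std_normal_density x) \<partial>lborel)"
  by (simp_all add: below_int_def above_int_def interval_lebesgue_integral_def set_lebesgue_integral_def)

lemma integrable_half_line:
  fixes k :: "real \<Rightarrow> real"
  assumes "integrable lborel k" "A \<in> sets borel"
  shows "integrable lborel (\<lambda>x. indicator A x * k x)"
  using integrable_mult_indicator[of A lborel k] assms by simp

lemma integrable_quadratic_std_normal:
  "integrable lborel (\<lambda>x. (a + b * x + c * x\<^sup>2) * std_normal_density x)"
proof -
  have "integrable lborel (\<lambda>x. a * (std_normal_density x * x ^ 0) + b * (std_normal_density x * x ^ 1)
      + c * (std_normal_density x * x ^ 2))"
    by (intro Bochner_Integration.integrable_add integrable_mult_right integrable_std_normal_moment)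
  then show ?thesis by (simp add: algebra_simps)
qed

lemma below_int_mono:
  assumes "integrable lborel (\<lambda>x. k x * std_normal_density x)" "integrable lborel (\<lambda>x. l x * std_normal_density x)"
    and "\<And>x. x < w \<Longrightarrow> k x \<le> l x"
  shows "below_int k w \<le> below_int l w"
  unfolding below_int_eq
  by (intro integral_mono integrable_half_line assms)
    (auto simp: indicator_def intro!: mult_right_mono assms(3))

lemma above_int_mono:
  assumes "integrable lborel (\<lambda>x. k x * std_normal_density x)" "integrable lborel (\<lambda>x. l x * std_normal_density x)"
    and "\<And>x. x > w \<Longrightarrow> k x \<le> l x"
  shows "above_int k w \<le> above_int l w"
  unfolding above_int_eq
  by (intro integral_mono integrable_half_line assms)
    (auto simp: indicator_def intro!: mult_right_mono assms(3))

lemma half_int_linear: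
  assumes k: "integrable lborel (\<lambda>x. k x * std_normal_density x)"
    and l: "integrable lborel (\<lambda>x. l x * std_normal_density x)"
  shows "below_int (\<lambda>x. a * k x + b * l x) w = a * below_int k w + b * below_int l w"
    and "above_int (\<lambda>x. a * k x + b * l x) w = a * above_int k w + b * above_int l w"
proof -
  have "(\<integral>x. indicator A x * ((a * k x + b * l x) * std_normal_density x) \<partial>lborel) =
      a * (\<integral>x. indicator A x * (k x * std_normal_density x) \<partial>lborel) +
      b * (\<integral>x. indicator A x * (l x * std_normal_density x) \<partial>lborel)" if "A \<in> sets borel" for A :: "real set"
  proof -
    have "(\<integral>x. indicator A x * ((a * k x + b * l x) * std_normal_density x) \<partial>lborel) =
        (\<integral>x. a * (indicator A x * (k x * std_normal_density x)) +
          b * (indicator A x * (l x * std_normal_density x)) \<partial>lborel)"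
      by (intro Bochner_Integration.integral_cong) (auto simp: algebra_simps)
    also have "\<dots> = a * (\<integral>x. indicator A x * (k x * std_normal_density x) \<partial>lborel) +
      b * (\<integral>x. indicator A x * (l x * std_normal_density x) \<partial>lborel)"
      using integrable_half_line[OF k that] integrable_half_line[OF l that] by simp
    finally show ?thesis .
  qed
  then show "below_int (\<lambda>x. a * k x + b * l x) w = a * below_int k w + b * below_int l w"
    "above_int (\<lambda>x. a * k x + b * l x) w = a * above_int k w + b * above_int l w"
    unfolding below_int_eq above_int_eq by auto
qed

lemma below_plus_above:
  assumes k: "integrable lborel (\<lambda>x. k x * std_normal_density x)"
  shows "below_int k w + above_int k w = (\<integral>x. k x * std_normal_density x \<partial>lborel)"
proof -
  let ?k = "\<lambda>x. k x * std_normal_density x"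
  have "below_int k w + above_int k w = (\<integral>x. indicator {..<w} x * ?k x + indicator {w<..} x * ?k x \<partial>lborel)"
    unfolding below_int_eq above_int_eq
    by (intro Bochner_Integration.integral_add[symmetric] integrable_half_line k) auto
  also have "\<dots> = (\<integral>x. ?k x \<partial>lborel)"
  proof (rule integral_cong_AE)
    have "AE x in lborel. x \<noteq> w" by (rule AE_lborel_singleton)
    then show "AE x in lborel. indicator {..<w} x * ?k x + indicator {w<..} x * ?k x = ?k x"
      by eventually_elim (auto simp: indicator_def)
    show "?k \<in> borel_measurable lborel" using k by auto
    show "(\<lambda>x. indicator {..<w} x * ?k x + indicator {w<..} x * ?k x) \<in> borel_measurable lborel"
      using integrable_half_line[OF k, of "{..<w}"] integrable_half_line[OF k, of "{w<..}"]
      by (intro borel_measurable_add borel_measurable_integrable) auto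
  qed
  finally show ?thesis .
qed

lemma std_normal_density_deriv:
  "(std_normal_density has_real_derivative - x * std_normal_density x) (at x)"
  unfolding std_normal_density_def by (auto intro!: derivative_eq_intros simp: field_simps)

lemma affine_std_normal_tendsto_0:
  "((\<lambda>x. (a + b * x) * std_normal_density x) \<longlongrightarrow> 0) at_top"
  "((\<lambda>x. (a + b * x) * std_normal_density x) \<longlongrightarrow> 0) at_bot"
proof -
  have top: "((\<lambda>x::real. exp (- x\<^sup>2 / 2)) \<longlongrightarrow> 0) at_top" "((\<lambda>x::real. x * exp (- x\<^sup>2 / 2)) \<longlongrightarrow> 0) at_top"
    and bot: "((\<lambda>x::real. exp (- x\<^sup>2 / 2)) \<longlongrightarrow> 0) at_bot" "((\<lambda>x::real. x * exp (- x\<^sup>2 / 2)) \<longlongrightarrow> 0) at_bot"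
    by real_asymp+
  have eq: "(a + b * x) * std_normal_density x =
      1 / sqrt (2 * pi) * (a * exp (- x\<^sup>2 / 2) + b * (x * exp (- x\<^sup>2 / 2)))" for x
    by (simp add: std_normal_density_def field_simps)
  show "((\<lambda>x. (a + b * x) * std_normal_density x) \<longlongrightarrow> 0) at_top"
    unfolding eq by (rule tendsto_eq_intros top refl | simp)+
  show "((\<lambda>x. (a + b * x) * std_normal_density x) \<longlongrightarrow> 0) at_bot"
    unfolding eq by (rule tendsto_eq_intros bot refl | simp)+
qed

text \<open>The integrand is chosen backwards, as the derivative of
  \<open>(a + b * x) * std_normal_density x\<close>. Together with the integral of the density this
  evaluates all quadratic integrands.\<close>

lemma half_int_affine_antiderivative:
  fixes a b w :: real
  defines "k \<equiv> \<lambda>x. b - a * x - b * x\<^sup>2"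
  shows "below_int k w = (a + b * w) * std_normal_density w"
    and "above_int k w = - ((a + b * w) * std_normal_density w)"
proof -
  let ?F = "\<lambda>x. (a + b * x) * std_normal_density x"
  have F: "(?F has_real_derivative k x * std_normal_density x) (at x)" for x
    unfolding k_def
    by (rule derivative_eq_intros std_normal_density_deriv refl)+ (simp add: algebra_simps power2_eq_square)
  have cont: "isCont (\<lambda>x. k x * std_normal_density x) x" for x
    unfolding k_def std_normal_density_def by (intro continuous_intros) auto
  have int: "integrable lborel (\<lambda>x. k x * std_normal_density x)"
    using integrable_quadratic_std_normal[of b "- a" "- b"] by (simp add: k_def)
  have at_w: "(?F \<longlongrightarrow> ?F w) (at w)"
    using DERIV_isCont[OF F] by (simp add: isCont_def)
  have set_int: "set_integrable lborel (einterval c d) (\<lambda>x. k x * std_normal_density x)" for c d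
    using integrable_half_line[OF int, of "einterval c d"] by (simp add: set_integrable_def)
  have "(LBINT x=-\<infinity>..ereal w. k x * std_normal_density x) = ?F w - 0"
  proof (rule interval_integral_FTC_integrable)
    show "((?F \<circ> real_of_ereal) \<longlongrightarrow> 0) (at_right (- \<infinity>))"
      unfolding ereal_tendsto_simps by (rule affine_std_normal_tendsto_0)
    show "((?F \<circ> real_of_ereal) \<longlongrightarrow> ?F w) (at_left (ereal w))"
      unfolding ereal_tendsto_simps by (rule filterlim_mono[OF at_w order_refl at_le]) auto
  qed (use F cont set_int in \<open>auto simp: has_real_derivative_iff_has_vector_derivative simp del: einterval_eq\<close>)
  then show "below_int k w = ?F w" by (simp add: below_int_def)
  have "(LBINT x=ereal w..\<infinity>. k x * std_normal_density x) = 0 - ?F w"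
  proof (rule interval_integral_FTC_integrable)
    show "((?F \<circ> real_of_ereal) \<longlongrightarrow> 0) (at_left \<infinity>)"
      unfolding ereal_tendsto_simps by (rule affine_std_normal_tendsto_0)
    show "((?F \<circ> real_of_ereal) \<longlongrightarrow> ?F w) (at_right (ereal w))"
      unfolding ereal_tendsto_simps by (rule filterlim_mono[OF at_w order_refl at_le]) auto
  qed (use F cont set_int in \<open>auto simp: has_real_derivative_iff_has_vector_derivative simp del: einterval_eq\<close>)
  then show "above_int k w = - ?F w" by (simp add: above_int_def)
qed

text \<open>The two Mills ratio bounds express that the integrals of \<open>(x - w)\<^sup>2\<close> are nonnegative.\<close>

lemma half_int_normal:
  defines "P \<equiv> below_int (\<lambda>_. 1)" and "Q \<equiv> above_int (\<lambda>_. 1)"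
  shows "P w + Q w = 1"
    and "below_int (\<lambda>x. x) w = - std_normal_density w"
    and "above_int (\<lambda>x. x) w = std_normal_density w"
    and "(1 + w\<^sup>2) * P w + w * std_normal_density w \<ge> 0"
    and "(1 + w\<^sup>2) * Q w - w * std_normal_density w \<ge> 0"
proof -
  have int: "integrable lborel (\<lambda>x. 1 * std_normal_density x)"
    "integrable lborel (\<lambda>x. x * std_normal_density x)"
    "integrable lborel (\<lambda>x. (1 - (- 2 * w) * x - 1 * x\<^sup>2) * std_normal_density x)"
    using integrable_quadratic_std_normal[of 1 0 0] integrable_quadratic_std_normal[of 0 1 0]
      integrable_quadratic_std_normal[of 1 "2 * w" "- 1"] by simp_all
  show "P w + Q w = 1"
    using below_plus_above[OF int(1), of w] by (simp add: P_def Q_def)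
  show "below_int (\<lambda>x. x) w = - std_normal_density w" "above_int (\<lambda>x. x) w = std_normal_density w"
    using half_int_affine_antiderivative[of 0 "- 1" w] by simp_all
  \<comment> \<open>A constant plus an integrand with affine antiderivative, taken with
    \<open>a = - 2 * w\<close> and \<open>b = 1\<close>.\<close>
  have sq: "(1 + w\<^sup>2) * 1 + (- 1) * (1 - (- 2 * w) * x - 1 * x\<^sup>2) = (x - w)\<^sup>2" for x
    by (simp add: power2_eq_square algebra_simps)
  note lin = half_int_linear[OF int(1,3), of "1 + w\<^sup>2" "- 1" w, unfolded sq]
  have "below_int (\<lambda>x. (x - w)\<^sup>2) w \<ge> 0" "above_int (\<lambda>x. (x - w)\<^sup>2) w \<ge> 0"
    unfolding below_int_eq above_int_eq by (intro integral_nonneg_AE; simp)+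
  then show "(1 + w\<^sup>2) * P w + w * std_normal_density w \<ge> 0"
    "(1 + w\<^sup>2) * Q w - w * std_normal_density w \<ge> 0"
    unfolding lin half_int_affine_antiderivative P_def Q_def by (simp_all add: algebra_simps)
qed

lemma lipschitz_integrable_std_normal:
  fixes h :: "real \<Rightarrow> real"
  assumes h: "\<And>x y. \<bar>h x - h y\<bar> \<le> \<bar>x - y\<bar>"
  shows "continuous_on UNIV h" and "integrable lborel (\<lambda>x. h x * std_normal_density x)"
proof -
  show cont: "continuous_on UNIV h"
    by (rule lipschitz_on_continuous_on[of 1]) (auto simp: lipschitz_on_def dist_real_def h)
  then have [measurable]: "h \<in> borel_measurable borel" by (rule borel_measurable_continuous_onI)
  show "integrable lborel (\<lambda>x. h x * std_normal_density x)"
  proof (rule Bochner_Integration.integrable_bound[where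
        f = "\<lambda>x. \<bar>h 0\<bar> * (std_normal_density x * \<bar>x\<bar> ^ 0) + std_normal_density x * \<bar>x\<bar> ^ 1"])
    show "integrable lborel (\<lambda>x. \<bar>h 0\<bar> * (std_normal_density x * \<bar>x\<bar> ^ 0) + std_normal_density x * \<bar>x\<bar> ^ 1)"
      by (intro Bochner_Integration.integrable_add integrable_mult_right integrable_std_normal_moment_abs)
    have "\<bar>h x\<bar> * std_normal_density x \<le> (\<bar>h 0\<bar> + \<bar>x\<bar>) * std_normal_density x" for x
      using h[of x 0] by (intro mult_right_mono) auto
    then show "AE x in lborel. norm (h x * std_normal_density x) \<le>
        norm (\<bar>h 0\<bar> * (std_normal_density x * \<bar>x\<bar> ^ 0) + std_normal_density x * \<bar>x\<bar> ^ 1)"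
      by (auto simp: abs_mult algebra_simps)
  qed measurable
qed

text \<open>Solves \<open>f' w - w * f w = h w - c\<close> with \<open>c\<close> the normal mean of
  \<open>h\<close>: the density is an integrating factor, since the left side times it is the
  derivative of \<open>f w * std_normal_density w\<close>.\<close>

definition stein_solution :: "(real \<Rightarrow> real) \<Rightarrow> real \<Rightarrow> real" where
  "stein_solution h w =
     below_int (\<lambda>x. h x - (\<integral>x. h x * std_normal_density x \<partial>lborel)) w / std_normal_density w"

lemma below_int_deriv:
  assumes k: "continuous_on UNIV k" "integrable lborel (\<lambda>x. k x * std_normal_density x)"
  shows "(below_int k has_real_derivative k w * std_normal_density w) (at w)"
proof -
  let ?k = "\<lambda>x. k x * std_normal_density x"
  have cont: "continuous_on A ?k" for A
    unfolding std_normal_density_def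
    by (intro continuous_intros continuous_on_subset[OF k(1)]) auto
  \<comment> \<open>Only the second integral depends on \<open>u\<close>, and the base point
    \<open>w - 1\<close> makes \<open>w\<close> interior to a compact interval.\<close>
  have split: "below_int k u = below_int k (w - 1) + (LBINT x=ereal (w - 1)..ereal u. ?k x)" for u
    unfolding below_int_def
    by (rule interval_integral_sum[symmetric])
      (use integrable_half_line[OF k(2)] in \<open>simp add: interval_lebesgue_integrable_def set_integrable_def\<close>)
  have "((\<lambda>u. LBINT x=ereal (w - 1)..ereal u. ?k x) has_vector_derivative ?k w) (at w within {w - 1..w + 1})"
    by (rule interval_integral_FTC2) (use cont in auto)
  then have "((\<lambda>u. LBINT x=ereal (w - 1)..ereal u. ?k x) has_real_derivative ?k w) (at w)"
    by (simp add: has_real_derivative_iff_has_vector_derivative at_within_Icc_at)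
  then have "((\<lambda>u. below_int k (w - 1) + (LBINT x=ereal (w - 1)..ereal u. ?k x)) has_real_derivative
      0 + ?k w) (at w)"
    by (intro DERIV_add DERIV_const)
  then show ?thesis by (simp add: split[symmetric])
qed

lemma stein_solution_deriv:
  assumes h: "\<And>x y. \<bar>h x - h y\<bar> \<le> \<bar>x - y\<bar>"
  shows "(stein_solution h has_real_derivative
    w * stein_solution h w + h w - (\<integral>x. h x * std_normal_density x \<partial>lborel)) (at w)"
proof -
  define c where "c = (\<integral>x. h x * std_normal_density x \<partial>lborel)"
  note lip = lipschitz_integrable_std_normal[OF h]
  have "integrable lborel (\<lambda>x. (h x - c) * std_normal_density x)"
    using lip(2) integrable_quadratic_std_normal[of c 0 0] by (simp add: left_diff_distrib)
  then have d: "(below_int (\<lambda>x. h x - c) has_real_derivative (h w - c) * std_normal_density w) (at w)"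
    by (intro below_int_deriv continuous_intros lip)
  have pos: "std_normal_density w > 0" by (rule normal_density_pos) simp
  have "((\<lambda>w. below_int (\<lambda>x. h x - c) w / std_normal_density w) has_real_derivative
      w * (below_int (\<lambda>x. h x - c) w / std_normal_density w) + h w - c) (at w)"
    using pos by (auto intro!: derivative_eq_intros d std_normal_density_deriv simp: field_simps power2_eq_square)
  then show ?thesis by (simp add: stein_solution_def[abs_def] c_def)
qed

text \<open>The bounded quantity is the derivative of \<open>w * stein_solution h w\<close>.
  Centring \<open>h\<close> at \<open>h w\<close> writes it, times the density, as
  \<open>A * ?M - B * ?N\<close>; the Mills ratio bounds make \<open>?M\<close> and
  \<open>?N\<close> nonnegative, and the Lipschitz condition bounds \<open>A\<close> and
  \<open>B\<close>. The value 1 is attained for \<open>h x = x\<close>.\<close>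

lemma stein_solution_second_order_bound:
  assumes h: "\<And>x y. \<bar>h x - h y\<bar> \<le> \<bar>x - y\<bar>"
  shows "\<bar>(1 + w\<^sup>2) * stein_solution h w + w * (h w - (\<integral>x. h x * std_normal_density x \<partial>lborel))\<bar> \<le> 1"
proof -
  define c where "c = (\<integral>x. h x * std_normal_density x \<partial>lborel)"
  define \<phi> where "\<phi> = std_normal_density w"
  define P where "P = below_int (\<lambda>_. 1) w"
  define Q where "Q = above_int (\<lambda>_. 1) w"
  define A where "A = below_int (\<lambda>x. h x - h w) w"
  define B where "B = above_int (\<lambda>x. h x - h w) w"
  note normal = half_int_normal[of w, folded P_def Q_def \<phi>_def]
  have pos: "\<phi> > 0" unfolding \<phi>_def by (rule normal_density_pos) simp
  have int: "integrable lborel (\<lambda>x. 1 * std_normal_density x)"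
    "integrable lborel (\<lambda>x. x * std_normal_density x)"
    "integrable lborel (\<lambda>x. (h x - a) * std_normal_density x)"
    "integrable lborel (\<lambda>x. (a * 1 + b * x) * std_normal_density x)" for a b
    using integrable_quadratic_std_normal[of 1 0 0] integrable_quadratic_std_normal[of 0 1 0]
      integrable_quadratic_std_normal[of a 0 0] integrable_quadratic_std_normal[of a b 0]
      lipschitz_integrable_std_normal(2)[OF h]
    by (simp_all add: left_diff_distrib)
  have "A + B = (\<integral>x. (h x - h w) * std_normal_density x \<partial>lborel)"
    unfolding A_def B_def by (rule below_plus_above[OF int(3)])
  also have "\<dots> = c - h w"
    using lipschitz_integrable_std_normal(2)[OF h] int(1) by (simp add: left_diff_distrib c_def)
  finally have AB: "c = h w + A + B" by simp
  have "below_int (\<lambda>x. h x - c) w = 1 * A + (h w - c) * P"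
    unfolding A_def P_def half_int_linear(1)[OF int(3) int(1), symmetric] by simp
  also have "\<dots> = A * (P + Q) - (A + B) * P"
    unfolding normal(1) by (simp add: AB algebra_simps)
  finally have f: "below_int (\<lambda>x. h x - c) w = A * Q - B * P" by (simp add: algebra_simps)
  have lin: "below_int (\<lambda>x. a * 1 + b * x) w = a * P - b * \<phi>"
    "above_int (\<lambda>x. a * 1 + b * x) w = a * Q + b * \<phi>" for a b
    using half_int_linear[OF int(1,2), of a b w] normal(2,3) by (simp_all add: P_def Q_def)
  have "A \<le> w * P - (- 1) * \<phi>" "(- w) * P - 1 * \<phi> \<le> A"
    unfolding A_def lin[symmetric]
    by (intro below_int_mono int; use h[of _ w] in \<open>simp add: abs_le_iff\<close>; smt)+
  then have A: "\<bar>A\<bar> \<le> w * P + \<phi>" by simp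
  have "B \<le> (- w) * Q + 1 * \<phi>" "w * Q + (- 1) * \<phi> \<le> B"
    unfolding B_def lin[symmetric]
    by (intro above_int_mono int; use h[of _ w] in \<open>simp add: abs_le_iff\<close>; smt)+
  then have B: "\<bar>B\<bar> \<le> \<phi> - w * Q" by simp
  let ?M = "(1 + w\<^sup>2) * Q - w * \<phi>" and ?N = "(1 + w\<^sup>2) * P + w * \<phi>"
  have "\<bar>A * ?M - B * ?N\<bar> \<le> \<bar>A\<bar> * ?M + \<bar>B\<bar> * ?N"
    using normal(4,5) abs_triangle_ineq4[of "A * ?M" "B * ?N"] by (simp add: abs_mult)
  also have "\<dots> \<le> (w * P + \<phi>) * ?M + (\<phi> - w * Q) * ?N"
    using A B normal(4,5) by (intro add_mono mult_right_mono) auto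
  \<comment> \<open>All products \<open>P * Q\<close> and all terms in \<open>\<phi>\<close> squared
    cancel, and so do those with \<open>w\<close> squared.\<close>
  also have "\<dots> = \<phi> * (P + Q)" by (simp add: algebra_simps power2_eq_square)
  finally have bound: "\<bar>A * ?M - B * ?N\<bar> \<le> \<phi>" by (simp add: normal(1))
  have "(1 + w\<^sup>2) * stein_solution h w + w * (h w - c) = (A * ?M - B * ?N) / \<phi>"
    using pos unfolding stein_solution_def c_def[symmetric] f \<phi>_def[symmetric]
    by (simp add: AB field_simps)
  then show ?thesis using bound pos by (simp add: c_def[symmetric] abs_divide)
qed

text \<open>Up to a constant the derivative of the solution is \<open>w * f w + h w\<close>, a sum
  of two 1-Lipschitz functions. Arguing this way keeps \<open>h\<close> from having to be
  differentiable, which matters for a primitive of a sign function.\<close>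

lemma stein_solution_deriv_lipschitz:
  fixes h :: "real \<Rightarrow> real"
  assumes h: "\<And>x y. \<bar>h x - h y\<bar> \<le> \<bar>x - y\<bar>"
  shows "\<bar>(x * stein_solution h x + h x) - (y * stein_solution h y + h y)\<bar> \<le> 2 * \<bar>x - y\<bar>"
proof -
  define c where "c = (\<integral>x. h x * std_normal_density x \<partial>lborel)"
  let ?f = "stein_solution h"
  have d: "((\<lambda>w. w * ?f w) has_real_derivative (1 + w\<^sup>2) * ?f w + w * (h w - c)) (at w)" for w
    by (rule derivative_eq_intros stein_solution_deriv h refl)+ (simp add: c_def algebra_simps power2_eq_square)
  have "\<bar>x * ?f x - y * ?f y\<bar> \<le> \<bar>x - y\<bar>"
  proof -
    have "norm (x * ?f x - y * ?f y) \<le> 1 * norm (x - y)"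
      by (rule field_differentiable_bound[where S = UNIV and f = "\<lambda>w. w * ?f w"])
        (use d stein_solution_second_order_bound[OF h] in \<open>auto simp: c_def\<close>)
    then show ?thesis by simp
  qed
  then have "\<bar>(x * ?f x - y * ?f y) + (h x - h y)\<bar> \<le> \<bar>x - y\<bar> + \<bar>x - y\<bar>"
    by (intro order_trans[OF abs_triangle_ineq] add_mono h)
  then show ?thesis by (simp add: algebra_simps)
qed

section \<open>The distance to the normal law\<close>

text \<open>The signed indicator of the interval between \<open>z\<close> and \<open>x\<close>,
  closed at the left like the jumps of a distribution function.\<close>

definition step_diff :: "real \<Rightarrow> real \<Rightarrow> real \<Rightarrow> real" where
  "step_diff z x t = indicator {z..} t - indicator {x..} t"

lemma step_diff_integral:
  "integrable lborel (step_diff z x)" "(\<integral>t. \<bar>step_diff z x t\<bar> \<partial>lborel) = \<bar>x - z\<bar>"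
proof -
  have "step_diff z x = (\<lambda>t. if z \<le> x then indicator {z..<x} t else - indicator {x..<z} t)"
    by (auto simp: step_diff_def indicator_def fun_eq_iff)
  moreover have "\<bar>step_diff z x t\<bar> = (if z \<le> x then indicator {z..<x} t else indicator {x..<z} t)" for t
    by (auto simp: step_diff_def indicator_def)
  ultimately show "integrable lborel (step_diff z x)" "(\<integral>t. \<bar>step_diff z x t\<bar> \<partial>lborel) = \<bar>x - z\<bar>"
    by (cases "z \<le> x"; simp)+
qed

lemma step_diff_measurable [measurable]:
  "case_prod (\<lambda>z t. step_diff z x t) \<in> borel_measurable (borel \<Otimes>\<^sub>M borel)"
proof -
  have "(\<lambda>(z, t). step_diff z x t) = (\<lambda>p. (if fst p \<le> snd p then 1 else 0) - (if x \<le> snd p then 1 else 0))"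
    by (auto simp: step_diff_def indicator_def fun_eq_iff)
  then show ?thesis by simp
qed

text \<open>Written with \<open>step_diff\<close> instead of an integral from \<open>0\<close> to \<open>x\<close>, so that Fubini's theorem turns its
  expectations into integrals against distribution functions. It is applied with \<open>s\<close> the sign of the
  difference of two distribution functions.\<close>

definition sign_primitive :: "(real \<Rightarrow> real) \<Rightarrow> real \<Rightarrow> real" where
  "sign_primitive s x = (\<integral>t. s t * step_diff 0 x t \<partial>lborel)"

context
  fixes s :: "real \<Rightarrow> real"
  assumes s_measurable [measurable]: "s \<in> borel_measurable borel" and s_bound: "\<And>t. \<bar>s t\<bar> \<le> 1"
begin

lemma sign_step_integrable: "integrable lborel (\<lambda>t. s t * step_diff z x t)"
proof (rule Bochner_Integration.integrable_bound[OF step_diff_integral(1)[of z x]])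
  show "AE t in lborel. norm (s t * step_diff z x t) \<le> norm (step_diff z x t)"
    using s_bound by (auto simp: abs_mult mult_left_le_one_le)
  have "step_diff z x \<in> borel_measurable lborel" using step_diff_integral(1)[of z x] by auto
  then show "(\<lambda>t. s t * step_diff z x t) \<in> borel_measurable lborel" by simp
qed

lemma sign_primitive_diff:
  "sign_primitive s x - sign_primitive s z = (\<integral>t. s t * step_diff z x t \<partial>lborel)"
proof -
  have "sign_primitive s x - sign_primitive s z = (\<integral>t. s t * step_diff 0 x t - s t * step_diff 0 z t \<partial>lborel)"
    unfolding sign_primitive_def by (simp add: sign_step_integrable)
  also have "\<dots> = (\<integral>t. s t * step_diff z x t \<partial>lborel)"
    by (intro Bochner_Integration.integral_cong) (auto simp: step_diff_def algebra_simps)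
  finally show ?thesis .
qed

lemma sign_step_abs_integral_le: "(\<integral>t. \<bar>s t * step_diff z x t\<bar> \<partial>lborel) \<le> \<bar>x - z\<bar>"
proof -
  have "(\<integral>t. \<bar>s t * step_diff z x t\<bar> \<partial>lborel) \<le> (\<integral>t. \<bar>step_diff z x t\<bar> \<partial>lborel)"
    by (intro integral_mono integrable_abs sign_step_integrable step_diff_integral)
      (use s_bound in \<open>auto simp: abs_mult mult_left_le_one_le\<close>)
  then show ?thesis by (simp add: step_diff_integral)
qed

lemma sign_primitive_lipschitz: "\<bar>sign_primitive s x - sign_primitive s z\<bar> \<le> \<bar>x - z\<bar>"
  unfolding sign_primitive_diff
  using sign_step_abs_integral_le[of z x] integral_abs_bound[of lborel "\<lambda>t. s t * step_diff z x t"]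
  by linarith

text \<open>Fubini for \<open>std_normal_density z * (s t * step_diff z x t)\<close>: integrating
  over \<open>z\<close> first yields the difference of distribution functions, over \<open>t\<close>
  first the increment of the primitive. The density times \<open>\<bar>x - z\<bar>\<close> dominates
  the inner absolute integral.\<close>

lemma sign_primitive_normal_diff:
  defines "\<Phi> \<equiv> \<lambda>t. (\<integral>z. indicator {..t} z * std_normal_density z \<partial>lborel)"
  shows "integrable lborel (\<lambda>t. s t * (\<Phi> t - indicator {x..} t))"
    and "(\<integral>t. s t * (\<Phi> t - indicator {x..} t) \<partial>lborel) =
      sign_primitive s x - (\<integral>z. sign_primitive s z * std_normal_density z \<partial>lborel)"
proof -
  let ?h = "sign_primitive s"
  let ?f = "\<lambda>z t. std_normal_density z * (s t * step_diff z x t)"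
  have f_meas: "case_prod ?f \<in> borel_measurable (lborel \<Otimes>\<^sub>M lborel)"
    by measurable
  have nd: "integrable lborel (\<lambda>x. std_normal_density x)"
    using integrable_std_normal_moment[of 0] by simp
  have h: "integrable lborel (\<lambda>z. ?h z * std_normal_density z)"
    by (rule lipschitz_integrable_std_normal(2)[OF sign_primitive_lipschitz])
  have "integrable lborel (\<lambda>z. \<integral>t. norm (?f z t) \<partial>lborel)"
  proof (rule Bochner_Integration.integrable_bound)
    show "integrable lborel (\<lambda>z. \<bar>x - z\<bar> * std_normal_density z)"
      by (rule lipschitz_integrable_std_normal(2)) auto
    show "(\<lambda>z. \<integral>t. norm (?f z t) \<partial>lborel) \<in> borel_measurable lborel"
      by measurable
    have "(\<integral>t. \<bar>?f z t\<bar> \<partial>lborel) = std_normal_density z * (\<integral>t. \<bar>s t * step_diff z x t\<bar> \<partial>lborel)" for z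
      by (simp add: abs_mult)
    moreover have "std_normal_density z * (\<integral>t. \<bar>s t * step_diff z x t\<bar> \<partial>lborel) \<le>
        std_normal_density z * \<bar>x - z\<bar>" for z
      by (intro mult_left_mono sign_step_abs_integral_le) simp
    ultimately show "AE z in lborel. norm (\<integral>t. norm (?f z t) \<partial>lborel) \<le> norm (\<bar>x - z\<bar> * std_normal_density z)"
      by (simp add: abs_mult mult.commute)
  qed
  then have int: "integrable (lborel \<Otimes>\<^sub>M lborel) (case_prod ?f)"
    by (intro lborel_pair.Fubini_integrable f_meas) (auto intro!: integrable_mult_right sign_step_integrable)
  have inner: "(\<integral>z. ?f z t \<partial>lborel) = s t * (\<Phi> t - indicator {x..} t)" for t
  proof -
    have "(\<integral>z. ?f z t \<partial>lborel) = (\<integral>z. s t * (indicator {..t} z * std_normal_density z) -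
        s t * indicator {x..} t * std_normal_density z \<partial>lborel)"
      by (intro Bochner_Integration.integral_cong)
        (auto simp: step_diff_def indicator_def algebra_simps)
    also have "\<dots> = s t * \<Phi> t - s t * indicator {x..} t * 1"
      using nd integrable_half_line[OF nd, of "{..t}"] by (simp add: \<Phi>_def)
    finally show ?thesis by (simp add: algebra_simps)
  qed
  show "integrable lborel (\<lambda>t. s t * (\<Phi> t - indicator {x..} t))"
    using lborel_pair.integrable_snd[OF int] by (simp only: inner)
  have "(\<integral>t. s t * (\<Phi> t - indicator {x..} t) \<partial>lborel) = (\<integral>z. (\<integral>t. ?f z t \<partial>lborel) \<partial>lborel)"
    unfolding inner[symmetric] by (rule lborel_pair.Fubini_integral[OF int])
  also have "\<dots> = (\<integral>z. ?h x * std_normal_density z - ?h z * std_normal_density z \<partial>lborel)"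
  proof (intro Bochner_Integration.integral_cong refl)
    fix z
    have "(\<integral>t. ?f z t \<partial>lborel) = std_normal_density z * (?h x - ?h z)"
      by (simp add: sign_primitive_diff)
    then show "(\<integral>t. ?f z t \<partial>lborel) = ?h x * std_normal_density z - ?h z * std_normal_density z"
      by (simp only: right_diff_distrib mult.commute)
  qed
  also have "\<dots> = ?h x - (\<integral>z. ?h z * std_normal_density z \<partial>lborel)"
    using nd h by simp
  finally show "(\<integral>t. s t * (\<Phi> t - indicator {x..} t) \<partial>lborel) =
      ?h x - (\<integral>z. ?h z * std_normal_density z \<partial>lborel)" .
qed

end

text \<open>Kantorovich duality in the easy direction: with \<open>s\<close> the sign of
  \<open>\<Phi> - F\<close>, the absolute difference is linear in \<open>F\<close>. Hence its
  integral is a finite mixture of the integrals for point masses, and the Stein equation turns that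
  into the assumed expression.\<close>

lemma L1_normal_le_stein:
  fixes p X :: "'i \<Rightarrow> real"
  assumes I: "finite I" and p1: "sum p I = 1"
    and stein: "\<And>g g'. (\<And>x. (g has_real_derivative g' x) (at x)) \<Longrightarrow>
        (\<And>x y. \<bar>g' x - g' y\<bar> \<le> 2 * \<bar>x - y\<bar>) \<Longrightarrow>
        \<bar>\<Sum>i\<in>I. p i * (g' (X i) - X i * g (X i))\<bar> \<le> B"
  shows "(\<integral>\<^sup>+t. ennreal \<bar>(\<Sum>i\<in>{i \<in> I. X i \<le> t}. p i) -
      (\<integral>z. indicator {..t} z * std_normal_density z \<partial>lborel)\<bar> \<partial>lborel) \<le> ennreal B"
proof -
  define \<Phi> where "\<Phi> t = (\<integral>z. indicator {..t} z * std_normal_density z \<partial>lborel)" for t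
  define F where "F t = (\<Sum>i\<in>I. p i * indicator {X i..} t)" for t
  have F: "(\<Sum>i\<in>{i \<in> I. X i \<le> t}. p i) = F t" for t
    using I by (auto simp: F_def indicator_def sum.If_cases Int_def intro!: sum.mono_neutral_cong_left)
  have nd: "integrable lborel (\<lambda>x. std_normal_density x)"
    using integrable_std_normal_moment[of 0] by simp
  have "mono \<Phi>"
    unfolding \<Phi>_def
    by (intro monoI integral_mono integrable_half_line nd) (auto simp: indicator_def)
  then have [measurable]: "\<Phi> \<in> borel_measurable borel" by (rule borel_measurable_mono)
  have [measurable]: "F \<in> borel_measurable borel" unfolding F_def by measurable
  define s where "s t = sgn (\<Phi> t - F t)" for t
  have [measurable]: "s \<in> borel_measurable borel" unfolding s_def by measurable
  have s_le: "\<bar>s t\<bar> \<le> 1" for t by (simp add: s_def abs_sgn_eq)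
  define h where "h = sign_primitive s"
  define c where "c = (\<integral>z. h z * std_normal_density z \<partial>lborel)"
  have h: "\<bar>h x - h y\<bar> \<le> \<bar>x - y\<bar>" for x y
    unfolding h_def by (rule sign_primitive_lipschitz) (use s_le in auto)
  have point: "integrable lborel (\<lambda>t. s t * (\<Phi> t - indicator {x..} t))"
    "(\<integral>t. s t * (\<Phi> t - indicator {x..} t) \<partial>lborel) = h x - c" for x
    using sign_primitive_normal_diff[of s x] s_le by (simp_all add: h_def c_def \<Phi>_def[abs_def])
  have abs_eq: "\<bar>F t - \<Phi> t\<bar> = (\<Sum>i\<in>I. p i * (s t * (\<Phi> t - indicator {X i..} t)))" for t
  proof -
    have "(\<Sum>i\<in>I. p i * (s t * (\<Phi> t - indicator {X i..} t))) = s t * (sum p I * \<Phi> t - F t)"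
      by (simp add: F_def sum_distrib_left sum_distrib_right sum_subtractf right_diff_distrib mult_ac)
    also have "\<dots> = \<bar>F t - \<Phi> t\<bar>" by (simp add: p1 s_def sgn_if abs_if)
    finally show ?thesis ..
  qed
  have "integrable lborel (\<lambda>t. \<bar>F t - \<Phi> t\<bar>)"
    unfolding abs_eq by (intro Bochner_Integration.integrable_sum integrable_mult_right point)
  then have "(\<integral>\<^sup>+t. ennreal \<bar>F t - \<Phi> t\<bar> \<partial>lborel) = ennreal (\<integral>t. \<bar>F t - \<Phi> t\<bar> \<partial>lborel)"
    by (rule nn_integral_eq_integral) auto
  also have "(\<integral>t. \<bar>F t - \<Phi> t\<bar> \<partial>lborel) = (\<Sum>i\<in>I. p i * (h (X i) - c))"
    unfolding abs_eq using point by (subst Bochner_Integration.integral_sum) auto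
  also have "\<dots> \<le> B"
  proof -
    let ?g = "stein_solution h"
    \<comment> \<open>The derivative in the form given by the Stein equation, so that
      \<open>?g' x - x * ?g x\<close> is \<open>h x - c\<close>.\<close>
    let ?g' = "\<lambda>x. x * ?g x + h x - c"
    have "\<bar>\<Sum>i\<in>I. p i * (?g' (X i) - X i * ?g (X i))\<bar> \<le> B"
    proof (rule stein)
      show "(?g has_real_derivative ?g' x) (at x)" for x
        using stein_solution_deriv[OF h] by (simp add: c_def)
      show "\<bar>?g' x - ?g' y\<bar> \<le> 2 * \<bar>x - y\<bar>" for x y
        using stein_solution_deriv_lipschitz[OF h, of x y] by simp
    qed
    then show ?thesis by simp
  qed
  finally show ?thesis by (simp add: F \<Phi>_def ennreal_leI)
qed

section \<open>The Jack measure\<close>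

lemma weighted_Cauchy_Schwarz:
  fixes w a b :: "'i \<Rightarrow> real"
  assumes "\<And>i. i \<in> I \<Longrightarrow> w i \<ge> 0"
  shows "(\<Sum>i\<in>I. w i * (a i * b i)) \<le> sqrt (\<Sum>i\<in>I. w i * (a i)\<^sup>2) * sqrt (\<Sum>i\<in>I. w i * (b i)\<^sup>2)"
proof -
  have "(\<Sum>i\<in>I. w i * (a i * b i)) = (\<Sum>i\<in>I. (sqrt (w i) * a i) * (sqrt (w i) * b i))"
  proof (rule sum.cong[OF refl])
    fix i assume "i \<in> I"
    have "(sqrt (w i) * a i) * (sqrt (w i) * b i) = (sqrt (w i) * sqrt (w i)) * (a i * b i)"
      by (simp only: mult_ac)
    then show "w i * (a i * b i) = (sqrt (w i) * a i) * (sqrt (w i) * b i)"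
      using assms[OF \<open>i \<in> I\<close>] by simp
  qed
  also have "\<dots> \<le> L2_set (\<lambda>i. sqrt (w i) * a i) I * L2_set (\<lambda>i. sqrt (w i) * b i) I"
    by (rule order_trans[OF sum_mono L2_set_mult_ineq]) (simp flip: abs_mult)
  also have "\<dots> = sqrt (\<Sum>i\<in>I. w i * (a i)\<^sup>2) * sqrt (\<Sum>i\<in>I. w i * (b i)\<^sup>2)"
    using assms by (simp add: L2_set_def power_mult_distrib cong: sum.cong_simp)
  finally show ?thesis .
qed

text \<open>As \<open>g'\<close> may fail to be differentiable, the remainder is compared with the
  square through the sign of a first derivative. Negative \<open>u\<close> is reduced to positive
  \<open>u\<close> by reflecting the axis.\<close>

lemma lipschitz_deriv_taylor:
  fixes g g' :: "real \<Rightarrow> real"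
  assumes g: "\<And>x. (g has_real_derivative g' x) (at x)"
    and lip: "\<And>x y. \<bar>g' x - g' y\<bar> \<le> 2 * \<bar>x - y\<bar>"
  shows "\<bar>g (s + u) - g s - u * g' s\<bar> \<le> u\<^sup>2"
proof -
  have pos: "\<bar>g (s + u) - g s - u * g' s\<bar> \<le> u\<^sup>2" if "u \<ge> 0"
    and g: "\<And>x. (g has_real_derivative g' x) (at x)"
    and lip: "\<And>x y. \<bar>g' x - g' y\<bar> \<le> 2 * \<bar>x - y\<bar>"
    for g g' :: "real \<Rightarrow> real" and s u :: real
  proof -
    have d: "((\<lambda>t. g (s + t) - g s - t * g' s) has_real_derivative g' (s + t) - g' s) (at t)" for t
      by (rule derivative_eq_intros DERIV_chain'[OF _ g] refl)+ simp
    have "g (s + u) - g s - u * g' s - u\<^sup>2 \<le> g (s + 0) - g s - 0 * g' s - 0\<^sup>2"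
    proof (rule DERIV_nonpos_imp_nonincreasing[OF that(1)])
      fix t assume t: "0 \<le> t" "t \<le> u"
      have "((\<lambda>t. g (s + t) - g s - t * g' s - t\<^sup>2) has_real_derivative g' (s + t) - g' s - 2 * t) (at t)"
        by (rule derivative_eq_intros d refl)+ simp
      moreover have "g' (s + t) - g' s - 2 * t \<le> 0" using lip[of "s + t" s] t by simp
      ultimately show "\<exists>y. ((\<lambda>t. g (s + t) - g s - t * g' s - t\<^sup>2) has_real_derivative y) (at t) \<and> y \<le> 0"
        by blast
    qed
    moreover have "g (s + u) - g s - u * g' s + u\<^sup>2 \<ge> g (s + 0) - g s - 0 * g' s + 0\<^sup>2"
    proof (rule DERIV_nonneg_imp_nondecreasing[OF that(1)])
      fix t assume t: "0 \<le> t" "t \<le> u"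
      have "((\<lambda>t. g (s + t) - g s - t * g' s + t\<^sup>2) has_real_derivative g' (s + t) - g' s + 2 * t) (at t)"
        by (rule derivative_eq_intros d refl)+ simp
      moreover have "g' (s + t) - g' s + 2 * t \<ge> 0" using lip[of "s + t" s] t by simp
      ultimately show "\<exists>y. ((\<lambda>t. g (s + t) - g s - t * g' s + t\<^sup>2) has_real_derivative y) (at t) \<and> y \<ge> 0"
        by blast
    qed
    ultimately show ?thesis by (simp add: abs_le_iff)
  qed
  show ?thesis
  proof (cases "u \<ge> 0")
    case True
    then show ?thesis using g lip by (rule pos)
  next
    case False
    have "\<bar>g (- (- s + - u)) - g (- (- s)) - (- u) * (- g' (- (- s)))\<bar> \<le> (- u)\<^sup>2"
    proof (rule pos)
      show "((\<lambda>x. g (- x)) has_real_derivative - g' (- x)) (at x)" for x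
        using DERIV_chain2[OF g DERIV_minus[OF DERIV_ident]] by simp
      show "\<bar>- g' (- x) - - g' (- y)\<bar> \<le> 2 * \<bar>x - y\<bar>" for x y
        using lip[of "- x" "- y"] by (simp add: abs_minus_commute)
    qed (use False in simp)
    then show ?thesis by (simp add: add.commute)
  qed
qed

lemma jack_mean_fourth_moment:
  assumes \<alpha>: "\<alpha> > 0" and n: "n < N"
  shows "jack_mean \<alpha> N n (\<lambda>f. \<Sum>r<N. up_weight \<alpha> N f r * row_end \<alpha> f r ^ 4) =
    2 * (\<alpha> * real n)\<^sup>2 + real n * (\<alpha> ^ 3 - 3 * \<alpha>\<^sup>2 + \<alpha>)"
proof -
  have "jack_mean \<alpha> N n (\<lambda>f. \<Sum>r<N. up_weight \<alpha> N f r * row_end \<alpha> f r ^ 4) =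
      jack_mean \<alpha> N n (\<lambda>f. 3 * \<alpha> * box_sum \<alpha> N 2 f + 3 * \<alpha> * (\<alpha> - 1) * box_sum \<alpha> N 1 f
        + ((\<alpha> ^ 3 - 3 / 2 * \<alpha>\<^sup>2 + \<alpha>) * real n + (\<alpha> * real n)\<^sup>2 / 2) * 1)"
    using up_weight_row_functions(4)[OF \<alpha> _ n] by (intro jack_mean_cong) simp
  also have "\<dots> = 3 * \<alpha> * (\<alpha> * real n * (real n - 1) / 2)
      + ((\<alpha> ^ 3 - 3 / 2 * \<alpha>\<^sup>2 + \<alpha>) * real n + (\<alpha> * real n)\<^sup>2 / 2)"
    unfolding jack_mean_linear jack_mean_moments[OF \<alpha> n] by simp
  also have "\<dots> = 2 * (\<alpha> * real n)\<^sup>2 + real n * (\<alpha> ^ 3 - 3 * \<alpha>\<^sup>2 + \<alpha>)"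
    by (simp add: power2_eq_square power3_eq_cube field_simps)
  finally show ?thesis .
qed

text \<open>\<open>W\<close> uses the scale \<open>\<sigma>\<close> of size \<open>Suc n\<close> on
  partitions of size \<open>n\<close> as well, so adding a box to row \<open>r\<close> moves
  \<open>W f\<close> to \<open>W f + u f r\<close>.\<close>

lemma jack_stein_bound:
  assumes \<alpha>: "\<alpha> > 0" and n: "n \<ge> 1" "n < N"
    and g: "\<And>x. (g has_real_derivative g' x) (at x)"
    and lip: "\<And>x y. \<bar>g' x - g' y\<bar> \<le> 2 * \<bar>x - y\<bar>"
  defines "\<sigma> \<equiv> sqrt (\<alpha> * (real (Suc n) / 2 * real n))"
  defines "W \<equiv> \<lambda>f. box_sum \<alpha> N 1 f / \<sigma>"
  shows "\<bar>jack_mean \<alpha> N (Suc n) (\<lambda>f. g' (W f) - W f * g (W f))\<bar> \<le>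
    sqrt (2 / real (Suc n)) * (2 + sqrt (2 + max \<alpha> (1 / \<alpha>) / real n))"
proof -
  define K where "K = real (Suc n) / 2"
  define u where "u f r = row_end \<alpha> f r / \<sigma>" for f r
  define w where "w p = jack \<alpha> N n (fst p) * up_weight \<alpha> N (fst p) (snd p)" for p
  define J where "J = row_functions N n \<times> {..<N}"
  let ?B = "box_sum \<alpha> N 1"
  have K: "K > 0" by (simp add: K_def)
  have \<sigma>: "\<sigma> > 0" "\<sigma>\<^sup>2 = \<alpha> * K * real n"
    using \<alpha> n(1) by (simp_all add: \<sigma>_def K_def)
  have joint: "jack_mean \<alpha> N n (\<lambda>f. \<Sum>r<N. up_weight \<alpha> N f r * G f r) = (\<Sum>p\<in>J. w p * G (fst p) (snd p))" for G
    by (simp add: jack_mean_def J_def w_def sum_distrib_left sum.cartesian_product split_def mult_ac)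
  have w: "w p \<ge> 0" if "p \<in> J" for p
    using that up_weight_nonneg[OF \<alpha>] row_functionsD(1) less_imp_le[OF jack_pos[OF \<alpha>]]
    by (auto simp: w_def J_def intro!: mult_nonneg_nonneg)
  have row: "(\<Sum>r<N. up_weight \<alpha> N f r * u f r) = 0" "(\<Sum>r<N. up_weight \<alpha> N f r * (u f r)\<^sup>2) = 1 / K"
    if f: "f \<in> row_functions N n" for f
  proof -
    show "(\<Sum>r<N. up_weight \<alpha> N f r * u f r) = 0"
      using up_weight_row_functions(2)[OF \<alpha> f n(2)] by (simp add: u_def sum_divide_distrib[symmetric])
    show "(\<Sum>r<N. up_weight \<alpha> N f r * (u f r)\<^sup>2) = 1 / K"
      using up_weight_row_functions(3)[OF \<alpha> f n(2)] K n(1) \<alpha>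
      by (simp add: u_def power_divide sum_divide_distrib[symmetric] \<sigma>)
  qed
  have m0: "(\<Sum>p\<in>J. w p * 1) = 1"
  proof -
    have "(\<Sum>p\<in>J. w p * 1) = jack_mean \<alpha> N n (\<lambda>f. \<Sum>r<N. up_weight \<alpha> N f r * 1)"
      by (rule joint[of "\<lambda>_ _. 1", symmetric])
    also have "\<dots> = jack_mean \<alpha> N n (\<lambda>f. 1)"
      using up_weight_row_functions(1)[OF \<alpha> _ n(2)] by (intro jack_mean_cong) simp
    finally show ?thesis by (simp add: jack_mean_moments[OF \<alpha> n(2)])
  qed
  have m2: "(\<Sum>p\<in>J. w p * (u (fst p) (snd p))\<^sup>2) = 1 / K"
  proof -
    have "(\<Sum>p\<in>J. w p * (u (fst p) (snd p))\<^sup>2) = jack_mean \<alpha> N n (\<lambda>f. 1 / K * 1)"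
      unfolding joint[of "\<lambda>f r. (u f r)\<^sup>2", symmetric] using row(2) by (intro jack_mean_cong) simp
    then show ?thesis unfolding jack_mean_linear by (simp add: jack_mean_moments[OF \<alpha> n(2)])
  qed
  have m4: "K\<^sup>2 * (\<Sum>p\<in>J. w p * u (fst p) (snd p) ^ 4) \<le> 2 + max \<alpha> (1 / \<alpha>) / real n"
  proof -
    have "\<sigma> ^ 4 = (\<alpha> * K * real n)\<^sup>2" unfolding \<sigma>(2)[symmetric] by simp
    then have "(\<Sum>p\<in>J. w p * u (fst p) (snd p) ^ 4) =
        (2 * (\<alpha> * real n)\<^sup>2 + real n * (\<alpha> ^ 3 - 3 * \<alpha>\<^sup>2 + \<alpha>)) / (\<alpha> * K * real n)\<^sup>2"
      unfolding jack_mean_fourth_moment[OF \<alpha> n(2), symmetric] joint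
      by (simp add: u_def power_divide sum_divide_distrib)
    then have "K\<^sup>2 * (\<Sum>p\<in>J. w p * u (fst p) (snd p) ^ 4) =
        (2 * (\<alpha> * real n)\<^sup>2 + real n * (\<alpha> ^ 3 - 3 * \<alpha>\<^sup>2 + \<alpha>)) / (\<alpha> * real n)\<^sup>2"
      using K by (simp add: power_mult_distrib)
    also have "\<dots> = 2 + (\<alpha> - 3 + 1 / \<alpha>) / real n"
      using \<alpha> n(1) by (simp add: field_simps power2_eq_square power3_eq_cube)
    finally have "K\<^sup>2 * (\<Sum>p\<in>J. w p * u (fst p) (snd p) ^ 4) = 2 + (\<alpha> - 3 + 1 / \<alpha>) / real n" .
    \<comment> \<open>The smaller of \<open>\<alpha>\<close> and \<open>1 / \<alpha>\<close> is at
      most 1 and is absorbed by the \<open>- 3\<close>.\<close>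
    moreover have "\<alpha> - 3 + 1 / \<alpha> \<le> max \<alpha> (1 / \<alpha>)"
    proof -
      have "\<alpha> \<le> 1 \<or> 1 / \<alpha> \<le> 1" using \<alpha> by auto
      then show ?thesis using max.cobounded1[of \<alpha> "1 / \<alpha>"] max.cobounded2[of "1 / \<alpha>" \<alpha>] by linarith
    qed
    ultimately show ?thesis by (simp add: divide_right_mono)
  qed
  have "jack_mean \<alpha> N (Suc n) (\<lambda>f. W f * g (W f)) = 1 / \<sigma> * jack_mean \<alpha> N (Suc n) (\<lambda>f. ?B f * g (?B f / \<sigma>))"
    unfolding jack_mean_linear(3)[symmetric] by (simp add: W_def)
  also have "\<dots> = 1 / \<sigma> * (K * (2 / real (Suc n) * jack_mean \<alpha> N (Suc n) (\<lambda>f. ?B f * g (?B f / \<sigma>))))"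
    by (simp add: K_def del: of_nat_Suc)
  also have "\<dots> = 1 / \<sigma> * (K * jack_mean \<alpha> N n (\<lambda>f. \<Sum>r<N. up_weight \<alpha> N f r *
      (row_end \<alpha> f r * g ((?B f + row_end \<alpha> f r) / \<sigma>))))"
    by (simp only: jack_mean_content_bias[OF \<alpha>, where \<phi> = "\<lambda>t. g (t / \<sigma>)"])
  also have "\<dots> = jack_mean \<alpha> N n (\<lambda>f. \<Sum>r<N. up_weight \<alpha> N f r * (K * (u f r * g (W f + u f r))))"
    unfolding jack_mean_linear(3)[symmetric]
    by (intro jack_mean_cong) (simp add: u_def W_def add_divide_distrib sum_distrib_left mult_ac)
  finally have bias: "jack_mean \<alpha> N (Suc n) (\<lambda>f. W f * g (W f)) =
      jack_mean \<alpha> N n (\<lambda>f. \<Sum>r<N. up_weight \<alpha> N f r * (K * (u f r * g (W f + u f r))))" .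
  have grow: "jack_mean \<alpha> N (Suc n) (\<lambda>f. g' (W f)) =
      jack_mean \<alpha> N n (\<lambda>f. \<Sum>r<N. up_weight \<alpha> N f r * g' (W f + u f r))"
    unfolding jack_mean_grow[OF \<alpha>, of N n]
  proof (intro jack_mean_cong sum.cong refl)
    fix f r assume "r \<in> {..<N}"
    then show "up_weight \<alpha> N f r * g' (W (f(r := Suc (f r)))) = up_weight \<alpha> N f r * g' (W f + u f r)"
      by (simp add: W_def u_def box_sum_add_box add_divide_distrib)
  qed
  \<comment> \<open>The Stein difference completed to Taylor remainders. The added terms average to
    0 given \<open>f\<close>: the mean of \<open>u\<close> is 0, and \<open>K\<close> times the mean
    of its square is 1, so the two multiples of \<open>g' (W f)\<close> cancel.\<close>
  define R where "R f r = g' (W f + u f r) - g' (W f) -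
      K * u f r * (g (W f + u f r) - g (W f) - u f r * g' (W f))" for f r
  have "jack_mean \<alpha> N (Suc n) (\<lambda>f. g' (W f) - W f * g (W f)) =
      jack_mean \<alpha> N n (\<lambda>f. (\<Sum>r<N. up_weight \<alpha> N f r * g' (W f + u f r)) -
        (\<Sum>r<N. up_weight \<alpha> N f r * (K * (u f r * g (W f + u f r)))))"
    unfolding jack_mean_linear(2) bias grow ..
  also have "\<dots> = jack_mean \<alpha> N n (\<lambda>f. \<Sum>r<N. up_weight \<alpha> N f r * R f r)"
  proof (rule jack_mean_cong)
    fix f assume f: "f \<in> row_functions N n"
    have "(\<Sum>r<N. up_weight \<alpha> N f r * R f r) =
        (\<Sum>r<N. up_weight \<alpha> N f r * g' (W f + u f r)) -
        (\<Sum>r<N. up_weight \<alpha> N f r * (K * (u f r * g (W f + u f r)))) -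
        g' (W f) * (\<Sum>r<N. up_weight \<alpha> N f r) +
        K * g (W f) * (\<Sum>r<N. up_weight \<alpha> N f r * u f r) +
        K * g' (W f) * (\<Sum>r<N. up_weight \<alpha> N f r * (u f r)\<^sup>2)"
      unfolding sum_distrib_left sum_subtractf[symmetric] sum.distrib[symmetric]
      by (intro sum.cong) (auto simp: R_def algebra_simps power2_eq_square)
    then show "(\<Sum>r<N. up_weight \<alpha> N f r * g' (W f + u f r)) -
        (\<Sum>r<N. up_weight \<alpha> N f r * (K * (u f r * g (W f + u f r)))) =
        (\<Sum>r<N. up_weight \<alpha> N f r * R f r)"
      using row[OF f] up_weight_row_functions(1)[OF \<alpha> f n(2)] K by simp
  qed
  also have "\<dots> = (\<Sum>p\<in>J. w p * R (fst p) (snd p))" by (rule joint)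
  finally have "\<bar>jack_mean \<alpha> N (Suc n) (\<lambda>f. g' (W f) - W f * g (W f))\<bar> \<le> (\<Sum>p\<in>J. \<bar>w p * R (fst p) (snd p)\<bar>)"
    by simp
  also have "\<dots> \<le> (\<Sum>p\<in>J. w p * (2 * \<bar>u (fst p) (snd p)\<bar> + K * (\<bar>u (fst p) (snd p)\<bar> * (u (fst p) (snd p))\<^sup>2)))"
  proof (rule sum_mono)
    fix p assume p: "p \<in> J"
    let ?u = "u (fst p) (snd p)" and ?s = "W (fst p)"
    have "\<bar>R (fst p) (snd p)\<bar> \<le> \<bar>g' (?s + ?u) - g' ?s\<bar> + \<bar>K * ?u * (g (?s + ?u) - g ?s - ?u * g' ?s)\<bar>"
      unfolding R_def by (rule abs_triangle_ineq4)
    also have "\<dots> \<le> 2 * \<bar>?u\<bar> + K * (\<bar>?u\<bar> * ?u\<^sup>2)"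
    proof (rule add_mono)
      show "\<bar>g' (?s + ?u) - g' ?s\<bar> \<le> 2 * \<bar>?u\<bar>" using lip[of "?s + ?u" ?s] by simp
      show "\<bar>K * ?u * (g (?s + ?u) - g ?s - ?u * g' ?s)\<bar> \<le> K * (\<bar>?u\<bar> * ?u\<^sup>2)"
        using K lipschitz_deriv_taylor[OF g lip, of ?s ?u]
        by (simp add: abs_mult mult_left_mono mult.assoc)
    qed
    finally show "\<bar>w p * R (fst p) (snd p)\<bar> \<le> w p * (2 * \<bar>?u\<bar> + K * (\<bar>?u\<bar> * ?u\<^sup>2))"
      using w[OF p] by (simp add: abs_mult mult_left_mono)
  qed
  also have "\<dots> = 2 * (\<Sum>p\<in>J. w p * (1 * \<bar>u (fst p) (snd p)\<bar>)) +
      K * (\<Sum>p\<in>J. w p * (\<bar>u (fst p) (snd p)\<bar> * (u (fst p) (snd p))\<^sup>2))"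
    by (simp add: sum_distrib_left sum.distrib distrib_left mult_ac)
  also have "\<dots> \<le> 2 * sqrt (1 / K) + K * (sqrt (1 / K) * sqrt (\<Sum>p\<in>J. w p * u (fst p) (snd p) ^ 4))"
  proof (intro add_mono mult_left_mono)
    show "(\<Sum>p\<in>J. w p * (1 * \<bar>u (fst p) (snd p)\<bar>)) \<le> sqrt (1 / K)"
      using weighted_Cauchy_Schwarz[of J w "\<lambda>_. 1" "\<lambda>p. \<bar>u (fst p) (snd p)\<bar>", OF w] m0 m2 by simp
    show "(\<Sum>p\<in>J. w p * (\<bar>u (fst p) (snd p)\<bar> * (u (fst p) (snd p))\<^sup>2)) \<le>
        sqrt (1 / K) * sqrt (\<Sum>p\<in>J. w p * u (fst p) (snd p) ^ 4)"
      using weighted_Cauchy_Schwarz[of J w "\<lambda>p. \<bar>u (fst p) (snd p)\<bar>" "\<lambda>p. (u (fst p) (snd p))\<^sup>2", OF w] m2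
      by simp
  qed (use K in auto)
  also have "\<dots> = sqrt (1 / K) * (2 + sqrt (K\<^sup>2 * (\<Sum>p\<in>J. w p * u (fst p) (snd p) ^ 4)))"
    using K by (simp add: real_sqrt_mult algebra_simps)
  also have "\<dots> \<le> sqrt (1 / K) * (2 + sqrt (2 + max \<alpha> (1 / \<alpha>) / real n))"
    using m4 K by (intro mult_left_mono add_left_mono real_sqrt_le_mono) auto
  finally show ?thesis by (simp add: K_def)
qed

section \<open>Translation between lists of parts and row functions\<close>

definition row_function :: "nat list \<Rightarrow> nat \<Rightarrow> nat" where
  "row_function p i = (if i < length p then p ! i else 0)"

lemma length_le_partition:
  assumes "p \<in> partitions_of n"
  shows "length p \<le> n"
proof -
  have "length p \<le> sum_list p" if "0 \<notin> set p" for p :: "nat list"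
    using that by (induction p) auto
  then show ?thesis using assms by (auto simp: partitions_of_def)
qed

text \<open>The inverse lists the values before the first zero; by monotonicity nothing but zeros
  follows. \<open>n \<le> N\<close> ensures that no partition has more than \<open>N\<close>
  parts.\<close>

lemma bij_betw_row_function:
  assumes "n \<le> N"
  shows "bij_betw row_function (partitions_of n) (row_functions N n)"
proof (rule bij_betw_byWitness[where f' = "\<lambda>f. map f [0..<(LEAST i. f i = 0)]"])
  show "\<forall>p\<in>partitions_of n. map (row_function p) [0..<(LEAST i. row_function p i = 0)] = p"
  proof
    fix p assume p: "p \<in> partitions_of n"
    have "(LEAST i. row_function p i = 0) = length p"
    proof (rule Least_equality)
      fix i assume "row_function p i = 0"
      then show "length p \<le> i"
        using p by (auto simp: row_function_def partitions_of_def split: if_splits) (metis nth_mem)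
    qed (simp add: row_function_def)
    then show "map (row_function p) [0..<(LEAST i. row_function p i = 0)] = p"
      by (auto simp: row_function_def intro: nth_equalityI)
  qed
  have LEAST: "f (LEAST i. f i = 0) = 0" "(LEAST i. f i = 0) \<le> N"
    if "f \<in> row_functions N n" for f
    using LeastI[of "\<lambda>i. f i = 0" N] Least_le[of "\<lambda>i. f i = 0" N] row_functionsD(2)[OF that, of N] by auto
  have inv: "row_function (map f [0..<(LEAST i. f i = 0)]) = f" if f: "f \<in> row_functions N n" for f
  proof
    fix i
    have "f i = 0" if "\<not> i < (LEAST i. f i = 0)"
      using antimonoD[OF row_functionsD(1)[OF f], of "LEAST i. f i = 0" i] LEAST(1)[OF f] that by simp
    then show "row_function (map f [0..<(LEAST i. f i = 0)]) i = f i"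
      by (auto simp: row_function_def)
  qed
  then show "\<forall>f\<in>row_functions N n. row_function (map f [0..<(LEAST i. f i = 0)]) = f" by blast
  show "row_function ` partitions_of n \<subseteq> row_functions N n"
  proof
    fix f assume "f \<in> row_function ` partitions_of n"
    then obtain p where p: "p \<in> partitions_of n" and f: "f = row_function p" by blast
    have "antimono f"
    proof (rule antimonoI)
      fix i j :: nat assume "i \<le> j"
      then show "f j \<le> f i"
        using p by (cases "i = j")
          (auto simp: f row_function_def partitions_of_def sorted_wrt_iff_nth_less)
    qed
    moreover have "(\<Sum>i<N. f i) = (\<Sum>i<length p. p ! i)"
      using length_le_partition[OF p] assms
      by (intro sum.mono_neutral_cong_right) (auto simp: f row_function_def)
    then have "(\<Sum>i<N. f i) = n"
      using p by (simp add: partitions_of_def sum_list_sum_nth atLeast0LessThan)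
    moreover have "f i = 0" if "i \<ge> N" for i
      using that length_le_partition[OF p] assms by (simp add: f row_function_def)
    ultimately show "f \<in> row_functions N n" by (simp add: row_functions_def)
  qed
  show "(\<lambda>f. map f [0..<(LEAST i. f i = 0)]) ` row_functions N n \<subseteq> partitions_of n"
  proof
    fix p assume "p \<in> (\<lambda>f. map f [0..<(LEAST i. f i = 0)]) ` row_functions N n"
    then obtain f where f: "f \<in> row_functions N n" and p: "p = map f [0..<(LEAST i. f i = 0)]" by blast
    have "(\<Sum>i<(LEAST i. f i = 0). f i) = (\<Sum>i<N. f i)"
    proof (rule sum.mono_neutral_left)
      show "\<forall>i\<in>{..<N} - {..<(LEAST i. f i = 0)}. f i = 0"
      proof
        fix i assume "i \<in> {..<N} - {..<(LEAST i. f i = 0)}"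
        then show "f i = 0"
          using antimonoD[OF row_functionsD(1)[OF f], of "LEAST i. f i = 0" i] LEAST(1)[OF f] by simp
      qed
    qed (use LEAST(2)[OF f] in auto)
    then have "sum_list p = n"
      using row_functionsD(3)[OF f] by (simp add: p sum_list_sum_nth atLeast0LessThan)
    moreover have "0 \<notin> set p" by (auto simp: p dest: not_less_Least)
    moreover have "sorted_wrt (\<ge>) p"
      using antimonoD[OF row_functionsD(1)[OF f]] by (simp add: p sorted_wrt_iff_nth_less)
    ultimately show "p \<in> partitions_of n" by (simp add: partitions_of_def)
  qed
qed

lemma boxes_row_function:
  assumes "length p \<le> N"
  shows "boxes p = Sigma {..<N} (\<lambda>i. {..<row_function p i})"
  using assms by (auto simp: boxes_def row_function_def split: if_splits)

lemma arm_row_function: "arm p (i, j) = row_function p i - Suc j"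
proof -
  have "{y \<in> boxes p. fst y = fst (i, j) \<and> snd y > snd (i, j)} = Pair i ` {j<..<row_function p i}"
    by (auto simp: boxes_def row_function_def image_iff split: if_splits)
  then show ?thesis by (simp add: arm_def card_image inj_on_def)
qed

lemma leg_row_function:
  assumes "length p \<le> N"
  shows "leg p (i, j) = leg_length N (row_function p) i j"
proof -
  have "{y \<in> boxes p. snd y = snd (i, j) \<and> fst y > fst (i, j)} =
      (\<lambda>k. (k, j)) ` {k \<in> {i<..<N}. j < row_function p k}"
    using assms by (auto simp: boxes_def row_function_def image_iff split: if_splits)
  then show ?thesis by (simp add: leg_def leg_length_def card_image inj_on_def)
qed

lemma jack_weight_row_function:
  assumes "length p \<le> N"
  shows "jack_weight n \<alpha> p = jack \<alpha> N n (row_function p)"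
proof -
  have "prod F (boxes p) = (\<Prod>i<N. \<Prod>j<row_function p i. F (i, j))" for F :: "nat \<times> nat \<Rightarrow> real"
    unfolding boxes_row_function[OF assms] by (subst prod.Sigma) auto
  then show ?thesis
    by (simp add: jack_weight_def jack_def hook_product_def row_hook_def arm_row_function
        leg_row_function[OF assms])
qed

lemma content_sum_row_function:
  assumes "length p \<le> N"
  shows "(\<Sum>x\<in>boxes p. alpha_content \<alpha> x) = box_sum \<alpha> N 1 (row_function p)"
  unfolding boxes_row_function[OF assms] box_sum_def
  by (subst sum.Sigma) (auto simp: alpha_content_def split_def)

section \<open>Distribution functions of the two laws and the final bound\<close>

lemma cdf_jack_W:
  assumes "finite (partitions_of n)" "\<And>p. p \<in> partitions_of n \<Longrightarrow> jack_weight n \<alpha> p \<ge> 0"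
  shows "cdf (distr (jack_measure n \<alpha>) borel (jack_W n \<alpha>)) t =
    (\<Sum>p\<in>{p \<in> partitions_of n. jack_W n \<alpha> p \<le> t}. jack_weight n \<alpha> p)"
proof -
  have "jack_W n \<alpha> \<in> borel_measurable (jack_measure n \<alpha>)"
    by (simp add: jack_measure_def)
  then have "cdf (distr (jack_measure n \<alpha>) borel (jack_W n \<alpha>)) t =
      measure (jack_measure n \<alpha>) {p \<in> partitions_of n. jack_W n \<alpha> p \<le> t}"
    by (auto simp: cdf_def measure_distr jack_measure_def space_point_measure intro!: arg_cong[where f = "measure _"])
  also have "\<dots> = (\<Sum>p\<in>{p \<in> partitions_of n. jack_W n \<alpha> p \<le> t}. jack_weight n \<alpha> p)"
  proof -
    have "emeasure (jack_measure n \<alpha>) {p \<in> partitions_of n. jack_W n \<alpha> p \<le> t} =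
        (\<Sum>p\<in>{p \<in> partitions_of n. jack_W n \<alpha> p \<le> t}. ennreal (jack_weight n \<alpha> p))"
      unfolding jack_measure_def using assms(1) by (intro emeasure_point_measure_finite) auto
    also have "\<dots> = ennreal (\<Sum>p\<in>{p \<in> partitions_of n. jack_W n \<alpha> p \<le> t}. jack_weight n \<alpha> p)"
      using assms(2) by (intro sum_ennreal) auto
    moreover have "0 \<le> (\<Sum>p\<in>{p \<in> partitions_of n. jack_W n \<alpha> p \<le> t}. jack_weight n \<alpha> p)"
      using assms(2) by (intro sum_nonneg) auto
    ultimately show ?thesis by (simp add: measure_def)
  qed
  finally show ?thesis .
qed

lemma cdf_std_normal:
  assumes "distributed P lborel Z std_normal_density"
  shows "cdf (distr P borel Z) t = (\<integral>z. indicator {..t} z * std_normal_density z \<partial>lborel)"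
proof -
  have "distr P borel Z = distr P lborel Z" by (rule distr_cong) auto
  also have "\<dots> = density lborel std_normal_density"
    using assms by (rule distributed_distr_eq_density)
  finally have "cdf (distr P borel Z) t = (\<integral>z. indicator {..t} z \<partial>density lborel std_normal_density)"
    by (simp add: cdf_def)
  also have "\<dots> = (\<integral>z. std_normal_density z *\<^sub>R indicator {..t} z \<partial>lborel)"
    by (rule integral_density) auto
  finally show ?thesis by (simp add: mult.commute)
qed

theorem theorem4p1:
  fixes n :: nat and \<alpha> :: real and P :: "'a measure" and Z :: "'a \<Rightarrow> real"
  assumes "n \<ge> 2" and "\<alpha> > 0"
    and "prob_space P" and "distributed P lborel Z std_normal_density"
  shows "L1_dist (distr (jack_measure n \<alpha>) borel (jack_W n \<alpha>)) (distr P borel Z)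
    \<le> ennreal (sqrt (2 / real n) * (2 + sqrt (2 + max \<alpha> (1 / \<alpha>) / (real n - 1))))"
proof -
  obtain m where n: "n = Suc m" and m: "m \<ge> 1" using assms(1) by (cases n) auto
  \<comment> \<open>One row more than boxes: normalisation at size \<open>n\<close> comes from
    \<open>jack_mean_moments\<close>, which asks for \<open>n < N\<close>.\<close>
  define N where "N = Suc n"
  have bij: "bij_betw row_function (partitions_of n) (row_functions N n)"
    by (rule bij_betw_row_function) (simp add: N_def)
  have fin: "finite (partitions_of n)"
    using bij_betw_finite[OF bij] finite_row_functions by blast
  have len: "length p \<le> N" if "p \<in> partitions_of n" for p
    using length_le_partition[OF that] by (simp add: N_def)
  have weight: "jack_weight n \<alpha> p = jack \<alpha> N n (row_function p)" if "p \<in> partitions_of n" for p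
    by (rule jack_weight_row_function[OF len[OF that]])
  define \<sigma> where "\<sigma> = sqrt (\<alpha> * (real (Suc m) / 2 * real m))"
  have "real (n choose 2) = real (Suc m) / 2 * real m"
    using real_of_nat_div[of 2 "Suc m * m"] by (simp add: n choose_two algebra_simps)
  then have W: "jack_W n \<alpha> p = box_sum \<alpha> N 1 (row_function p) / \<sigma>" if "p \<in> partitions_of n" for p
    by (simp add: jack_W_def content_sum_row_function[OF len[OF that]] \<sigma>_def)
  have mean: "(\<Sum>p\<in>partitions_of n. jack_weight n \<alpha> p * F (jack_W n \<alpha> p)) =
      jack_mean \<alpha> N n (\<lambda>f. F (box_sum \<alpha> N 1 f / \<sigma>))" for F
    unfolding jack_mean_def sum.reindex_bij_betw[OF bij, symmetric]
    by (intro sum.cong) (simp_all add: weight W)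
  have "L1_dist (distr (jack_measure n \<alpha>) borel (jack_W n \<alpha>)) (distr P borel Z) =
      (\<integral>\<^sup>+t. ennreal \<bar>(\<Sum>p\<in>{p \<in> partitions_of n. jack_W n \<alpha> p \<le> t}. jack_weight n \<alpha> p) -
        (\<integral>z. indicator {..t} z * std_normal_density z \<partial>lborel)\<bar> \<partial>lborel)"
    unfolding L1_dist_def cdf_std_normal[OF assms(4)]
    using fin weight less_imp_le[OF jack_pos[OF assms(2)]] by (subst cdf_jack_W) auto
  also have "\<dots> \<le> ennreal (sqrt (2 / real n) * (2 + sqrt (2 + max \<alpha> (1 / \<alpha>) / (real n - 1))))"
  proof (rule L1_normal_le_stein[OF fin])
    show "sum (jack_weight n \<alpha>) (partitions_of n) = 1"
      using mean[of "\<lambda>_. 1"] jack_mean_moments(1)[OF assms(2), of n N] by (simp add: N_def)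
    fix g g' :: "real \<Rightarrow> real"
    assume "\<And>x. (g has_real_derivative g' x) (at x)" "\<And>x y. \<bar>g' x - g' y\<bar> \<le> 2 * \<bar>x - y\<bar>"
    from jack_stein_bound[OF assms(2) m _ this, of N]
    show "\<bar>\<Sum>p\<in>partitions_of n. jack_weight n \<alpha> p * (g' (jack_W n \<alpha> p) - jack_W n \<alpha> p * g (jack_W n \<alpha> p))\<bar>
        \<le> sqrt (2 / real n) * (2 + sqrt (2 + max \<alpha> (1 / \<alpha>) / (real n - 1)))"
      unfolding mean[of "\<lambda>x. g' x - x * g x"] by (simp add: N_def n \<sigma>_def)
  qed
  finally show ?thesis .
qed

end
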